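(* On $\mathbb{S}^3\subset\mathbb{R}^4$ let $f(u)=u_1^3-\frac12u_1$ and $g(u)=(u_1^2-u_2^2)u_3-2u_1u_2u_4$. For $\alpha,\beta\in\mathbb{R}$ put $q_{\alpha,\beta}=\alpha f+\beta g$, and write $\mathscr E(q)=-V(q,q,1,1)$ and $V(q^{[4]})=V(q,q,q,q)$. Then $$\mathscr E(q_{\alpha,\beta})=\pi^2\left(\frac{\alpha^2}{32}+\frac{\beta^2}{12}\right),\qquad V(q_{\alpha,\beta}^{[4]})=\pi^2\left(-\frac{3\alpha^4}{128}+\frac{3\alpha^2\beta^2}{70}+\frac{\beta^4}{7}\right).$$ For every nonzero $q_{\alpha,\beta}$, $$-\frac{24}{\pi^2}\mathscr E(q_{\alpha,\beta})^2\leqslant V(q_{\alpha,\beta}^{[4]})\leqslant\frac{144}{7\pi^2}\mathscr E(q_{\alpha,\beta})^2.$$ Both constants are optimal on this plane: equality on the left occurs exactly on the $f$-axis ($\beta=0$) and equality on the right exactly on the $g$-axis ($\alpha=0$). Furthermore, for $(\alpha,\beta)\neq(0,0)$, $V(q_{\alpha,\beta}^{[4]})=0$ holds exactly on the two lines described by $$\frac{\beta^2}{\alpha^2}=\frac{\sqrt{1194}-12}{80}.$$ Consequently, for every $r>0$ there are nonspherical $C^\infty$ convex bodies in $\mathbb{R}^4$ of constant width $2r$, arbitrarily close to $rB^4$, whose quartic Wigner volume $V(h_{\mathrm{odd}},h_{\mathrm{odd}},h_{\mathrm{odd}},h_{\mathrm{odd}})$ vanishes, where $h_{\mathrm{odd}}$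 is the odd part of the support function.
   Context: For $C^2$ functions $f_1,\ldots,f_4$ on $\mathbb{S}^3$, the mixed volume is $$V(f_1,f_2,f_3,f_4)=\frac14\int_{\mathbb{S}^3}f_1\,D_3(Q_{f_2},Q_{f_3},Q_{f_4})\,\mathrm{d}\sigma,\qquad Q_f=\nabla^2_{\mathbb{S}^3}f+f\,\mathrm{Id},$$ where $\sigma$ is the (unnormalized) surface measure, $\nabla^2_{\mathbb{S}^3}$ is the covariant Hessian and $D_3$ is the polarized determinant (symmetric trilinear form with $D_3(A,A,A)=\det A$) on symmetric endomorphisms of the three-dimensional tangent space. It is the multilinear extension of the usual mixed volume of convex bodies, identified with their support functions $h_K(u)=\max_{x\in K}\langle x,u\rangle$; the function $1$ is the support function of the unit ball $B^4$. $K$ has constant width $2r$ if $h_K(u)+h_K(-u)=2r$ for all $u\in\mathbb{S}^3$. The odd part of $h_K$ is $h_{\mathrm{odd}}(u)=\frac{h_K(u)-h_K(-u)}2$. Closeness of bodies is in the Hausdorff metric; "nonspherical" means not a Euclidean ball. *)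

theory Defs
  imports "HOL-Analysis.Analysis"
begin

section \<open>Smooth maps\<close>

text \<open>Intended for open \<open>S\<close>; in finite dimension this is the usual notion of class \<open>C\<^sup>k\<close>.\<close>

fun Ck_on :: "nat \<Rightarrow> ('a::euclidean_space \<Rightarrow> 'b::euclidean_space) \<Rightarrow> 'a set \<Rightarrow> bool" where
  "Ck_on 0 f S \<longleftrightarrow> continuous_on S f"
| "Ck_on (Suc k) f S \<longleftrightarrow> (\<forall>x\<in>S. f differentiable (at x)) \<and>
     (\<forall>v. Ck_on k (\<lambda>x. frechet_derivative f (at x) v) S)"

definition smooth_on :: "('a::euclidean_space \<Rightarrow> 'b::euclidean_space) \<Rightarrow> 'a set \<Rightarrow> bool" where
  "smooth_on f S \<longleftrightarrow> (\<forall>k. Ck_on k f S)"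


section \<open>Calculus on the unit sphere\<close>

text \<open>
  A function (or vector field) on the unit sphere is represented by a function on the whole space of
  which only the values on the sphere matter. To differentiate it, it is extended to the punctured
  space as a function that is constant along rays from the origin.
\<close>

definition radial_ext :: "('a::euclidean_space \<Rightarrow> 'b) \<Rightarrow> 'a \<Rightarrow> 'b" where
  "radial_ext f x = f (x /\<^sub>R norm x)"

definition sphere_smooth :: "('a::euclidean_space \<Rightarrow> 'b::euclidean_space) \<Rightarrow> bool" where
  "sphere_smooth f \<longleftrightarrow> smooth_on (radial_ext f) (- {0})"

definition sphere_grad :: "('a::euclidean_space \<Rightarrow> real) \<Rightarrow> 'a \<Rightarrow> 'a" where
  "sphere_grad f u = (\<Sum>b\<in>Basis. frechet_derivative (radial_ext f) (at u) b *\<^sub>R b)"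

definition tangent_proj :: "'a::euclidean_space \<Rightarrow> 'a \<Rightarrow> 'a" where
  "tangent_proj u x = x - (x \<bullet> u) *\<^sub>R u"

text \<open>
  Levi-Civita connection of the round metric: the tangential part of the Euclidean derivative of the
  tangent field \<open>X\<close> at \<open>u\<close>, in the tangent direction \<open>v\<close>.
\<close>

definition covariant_deriv :: "('a::euclidean_space \<Rightarrow> 'a) \<Rightarrow> 'a \<Rightarrow> 'a \<Rightarrow> 'a" where
  "covariant_deriv X u v = tangent_proj u (frechet_derivative (radial_ext X) (at u) v)"

definition covariant_hessian :: "('a::euclidean_space \<Rightarrow> real) \<Rightarrow> 'a \<Rightarrow> 'a \<Rightarrow> 'a" where
  "covariant_hessian f u v = covariant_deriv (sphere_grad f) u v"

text \<open>The endomorphism \<open>Q\<^sub>f\<close> of the tangent space at \<open>u\<close>; only its values at vectors orthogonal to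
  \<open>u\<close> are meaningful.\<close>

definition Q_op :: "('a::euclidean_space \<Rightarrow> real) \<Rightarrow> 'a \<Rightarrow> 'a \<Rightarrow> 'a" where
  "Q_op f u v = covariant_hessian f u v + f u *\<^sub>R v"

text \<open>
  The unnormalized surface measure in polar coordinates:
  \<open>\<sigma>(A) = n \<lambda>({t u | 0 < t < 1, u \<in> A})\<close> with \<open>\<lambda>\<close> the Lebesgue measure on the \<open>n\<close>-dimensional space.
\<close>

definition surface_measure :: "'a::euclidean_space measure" where
  "surface_measure = scale_measure (of_nat DIM('a))
     (distr (restrict_space lborel (ball 0 1 - {0})) (restrict_space borel (sphere 0 1))
       (\<lambda>x. x /\<^sub>R norm x))"


section \<open>Polarized determinant and mixed volume on the three-sphere\<close>

definition orthonormal_frame :: "real^4 \<Rightarrow> (real^4)^3 \<Rightarrow> bool" where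
  "orthonormal_frame u e \<longleftrightarrow>
     (\<forall>i. e $ i \<bullet> u = 0) \<and> (\<forall>i j. e $ i \<bullet> e $ j = (if i = j then 1 else 0))"

text \<open>The determinant of an endomorphism of the tangent space at \<open>u\<close>, computed in an orthonormal
  basis; for linear \<open>A\<close> the value does not depend on the basis chosen.\<close>

definition tangent_matrix :: "real^4 \<Rightarrow> (real^4 \<Rightarrow> real^4) \<Rightarrow> real^3^3" where
  "tangent_matrix u A =
     (let e = (SOME e. orthonormal_frame u e) in (\<chi> i j. e $ i \<bullet> A (e $ j)))"

definition tangent_det :: "real^4 \<Rightarrow> (real^4 \<Rightarrow> real^4) \<Rightarrow> real" where
  "tangent_det u A = det (tangent_matrix u A)"

text \<open>Polarization identity for the cubic form \<open>det\<close>.\<close>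

definition D3 :: "real^4 \<Rightarrow> (real^4 \<Rightarrow> real^4) \<Rightarrow> (real^4 \<Rightarrow> real^4) \<Rightarrow> (real^4 \<Rightarrow> real^4) \<Rightarrow> real" where
  "D3 u A B C =
     (tangent_det u (\<lambda>v. A v + B v + C v)
      - tangent_det u (\<lambda>v. A v + B v) - tangent_det u (\<lambda>v. A v + C v) - tangent_det u (\<lambda>v. B v + C v)
      + tangent_det u A + tangent_det u B + tangent_det u C) / 6"

lemma D3_diag: "D3 u A A A = tangent_det u A"
proof -
  have div6: "x / 6 = y" if "x = 6 * y" for x y :: real
    using that by simp
  show ?thesis
    unfolding D3_def tangent_det_def tangent_matrix_def Let_def det_3 inner_add_right vec_lambda_beta
    by (rule div6) algebra
qed

lemma D3_commute: "D3 u A B C = D3 u B A C" "D3 u A B C = D3 u A C B"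
  by (simp_all add: D3_def add.commute add.left_commute)

lemma D3_add: "D3 u (\<lambda>v. A v + A' v) B C = D3 u A B C + D3 u A' B C"
  unfolding D3_def tangent_det_def tangent_matrix_def Let_def det_3 inner_add_right vec_lambda_beta
    add_divide_distrib[symmetric] by (rule arg_cong[where f = "\<lambda>x. x / 6"]) algebra

lemma D3_scale: "D3 u (\<lambda>v. c *\<^sub>R A v) B C = c * D3 u A B C"
  unfolding D3_def tangent_det_def tangent_matrix_def Let_def det_3 inner_add_right inner_scaleR_right
    vec_lambda_beta times_divide_eq_right by (rule arg_cong[where f = "\<lambda>x. x / 6"]) algebra

definition mixed_volume ::
  "(real^4 \<Rightarrow> real) \<Rightarrow> (real^4 \<Rightarrow> real) \<Rightarrow> (real^4 \<Rightarrow> real) \<Rightarrow> (real^4 \<Rightarrow> real) \<Rightarrow> real" where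
  "mixed_volume f1 f2 f3 f4 =
     1 / 4 * (LINT u|surface_measure. f1 u * D3 u (Q_op f2 u) (Q_op f3 u) (Q_op f4 u))"

definition energy :: "(real^4 \<Rightarrow> real) \<Rightarrow> real" where
  "energy q = - mixed_volume q q (\<lambda>_. 1) (\<lambda>_. 1)"

definition quartic_volume :: "(real^4 \<Rightarrow> real) \<Rightarrow> real" where
  "quartic_volume q = mixed_volume q q q q"

definition cubic_f :: "real^4 \<Rightarrow> real" where
  "cubic_f u = (u$1)^3 - 1/2 * u$1"

definition cubic_g :: "real^4 \<Rightarrow> real" where
  "cubic_g u = ((u$1)^2 - (u$2)^2) * u$3 - 2 * u$1 * u$2 * u$4"

definition q_comb :: "real \<Rightarrow> real \<Rightarrow> real^4 \<Rightarrow> real" where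
  "q_comb \<alpha> \<beta> u = \<alpha> * cubic_f u + \<beta> * cubic_g u"


section \<open>Convex bodies\<close>

definition convex_body :: "'a::euclidean_space set \<Rightarrow> bool" where
  "convex_body K \<longleftrightarrow> convex K \<and> compact K \<and> interior K \<noteq> {}"

definition support_function :: "'a::euclidean_space set \<Rightarrow> 'a \<Rightarrow> real" where
  "support_function K u = (SUP x\<in>K. x \<bullet> u)"

definition constant_width :: "'a::euclidean_space set \<Rightarrow> real \<Rightarrow> bool" where
  "constant_width K w \<longleftrightarrow>
     (\<forall>u\<in>sphere 0 1. support_function K u + support_function K (- u) = w)"

definition odd_part :: "('a::euclidean_space \<Rightarrow> real) \<Rightarrow> 'a \<Rightarrow> real" where
  "odd_part h u = (h u - h (- u)) / 2"

definition hausdorff_dist :: "'a::metric_space set \<Rightarrow> 'a set \<Rightarrow> real" where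
  "hausdorff_dist A B = max (SUP x\<in>A. infdist x B) (SUP y\<in>B. infdist y A)"

text \<open>Regular hypersurface of class \<open>C\<^sup>\<infinity>\<close>, by local parametrizations that are immersions and
  homeomorphisms onto relatively open pieces.\<close>

definition smooth_hypersurface :: "(real^4) set \<Rightarrow> bool" where
  "smooth_hypersurface S \<longleftrightarrow>
     (\<forall>p\<in>S. \<exists>(U :: (real^3) set) V \<phi> \<psi>. open U \<and> open V \<and> p \<in> V \<and>
        smooth_on \<phi> U \<and> homeomorphism U (V \<inter> S) \<phi> \<psi> \<and>
        (\<forall>x\<in>U. inj (frechet_derivative \<phi> (at x))))"

text \<open>
  Both the boundary and the support function are required to be of class \<open>C\<^sup>\<infinity>\<close>: neither implies
  the other, and together they express that the boundary is smooth with positive curvature. Smoothness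
  of the support function is what makes mixed volumes of the body accessible through \<open>mixed_volume\<close>.
\<close>

definition smooth_convex_body :: "(real^4) set \<Rightarrow> bool" where
  "smooth_convex_body K \<longleftrightarrow>
     convex_body K \<and> smooth_hypersurface (frontier K) \<and> sphere_smooth (support_function K)"

end

theory Submission
  imports Defs "HOL-Probability.Distributions" "HOL-Real_Asymp.Real_Asymp"
begin

text \<open>
  On the sphere, \<open>q = q_comb \<alpha> \<beta>\<close> is the restriction of a harmonic cubic \<open>P\<close>, and \<open>Q\<^sub>q\<close> is the tangential part of
  \<open>\<nabla>\<^sup>2P - 2P Id\<close>, whose trace is \<open>-12 P\<close>. In the left-invariant quaternionic frame its determinant is a polynomial,
  so both volumes reduce to moments of monomials over the sphere, which come from Gaussian
  integrals. For the bodies, take \<open>h = r + t q\<close> with \<open>t\<close> small and the convex hull of the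
  points \<open>N u\<close> with outer normal \<open>u\<close> read off from \<open>h\<close>: a quadratic gap
  \<open>h u - N v \<bullet> u \<ge> c |u - v|\<^sup>2\<close> gives at once the support function, the description of the boundary and the
  expansion bound that makes the boundary an immersed hypersurface.
\<close>

section \<open>Moments of monomials over the three-sphere\<close>

text \<open>Both volumes see a function only through its values on the unit sphere, and their
  formulas are proved for every function that agrees there with some
  \<open>q_comb \<alpha> \<beta>\<close>. This generality is essential: a support function is
  homogeneous of degree 1, so the odd part belonging to a body equals \<open>t q\<close> on the
  sphere but not off it. The determinant is defined with an unspecified orthonormal frame; an
  orthogonal change of frame makes it computable. Since \<open>D3 A Id Id\<close> is a third of the
  trace of \<open>A\<close>, the energy is simply the integral of \<open>q^2\<close> over the
  sphere. The constants -24 and 144/7 are, up to the factor 1/pi^2, the values of the ratio of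
  quartic volume to squared energy on the two axes. Quartic homogeneity lets a zero of the quartic
  volume survive multiplication by an arbitrarily small \<open>t\<close>. Such a body is no ball
  because the odd part of the support function of a ball is linear.\<close>

lemma scale_measure_eq_density: "scale_measure c M = density M (\<lambda>_. c)"
  by (rule measure_eqI) (simp_all add: emeasure_density nn_integral_cmult)

text \<open>The surface measure is a scaled push-forward of Lebesgue measure under radial
  projection, so a sphere integral becomes a ball integral of the extension of \<open>h\<close> that
  is constant along rays.\<close>

lemma integral_surface_measure:
  fixes h :: "'a::euclidean_space \<Rightarrow> real"
  assumes [measurable]: "h \<in> borel_measurable borel"
  shows "(LINT u|surface_measure. h u) =
    DIM('a) * (LINT x|lborel. indicator (ball 0 1 - {0}) x * h (x /\<^sub>R norm x))"
    and "integrable (surface_measure :: 'a measure) h \<longleftrightarrow>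
      integrable lborel (\<lambda>x. indicator (ball 0 1 - {0}) x * h (x /\<^sub>R norm x))"
proof -
  let ?N = "restrict_space borel (sphere 0 1) :: 'a measure"
  let ?B = "ball 0 1 - {0} :: 'a set"
  let ?M = "restrict_space lborel ?B"
  have B: "?B \<in> sets borel"
    by simp
  have "(\<lambda>x. x /\<^sub>R norm x) \<in> measurable (restrict_space borel ?B) ?N"
    by (rule measurable_restrict_space3) (auto intro!: borel_measurable_scaleR)
  then have [measurable]: "(\<lambda>x. x /\<^sub>R norm x) \<in> measurable ?M ?N"
    by (simp add: measurable_def space_restrict_space sets_restrict_space)
  have [measurable]: "h \<in> borel_measurable ?N"
    by (rule measurable_restrict_space1) fact
  have d: "ennreal (real DIM('a)) = of_nat DIM('a)"
    by (simp add: ennreal_of_nat_eq_real_of_nat)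
  show "(LINT u|surface_measure. h u) =
    DIM('a) * (LINT x|lborel. indicator ?B x * h (x /\<^sub>R norm x))"
    unfolding surface_measure_def scale_measure_eq_density d[symmetric]
    by (simp add: integral_density integral_distr integral_restrict_space)
  show "integrable (surface_measure :: 'a measure) h \<longleftrightarrow>
      integrable lborel (\<lambda>x. indicator ?B x * h (x /\<^sub>R norm x))"
    unfolding surface_measure_def scale_measure_eq_density d[symmetric]
    by (simp add: integrable_density integrable_distr_eq integrable_restrict_space)
qed

section \<open>Scaling and radial integration\<close>

lemma lborel_integral_scaleR:
  fixes f :: "'a::euclidean_space \<Rightarrow> real"
  assumes [measurable]: "f \<in> borel_measurable borel" and "c > 0"
  shows "(LINT x|lborel. f x) = c ^ DIM('a) * (LINT x|lborel. f (c *\<^sub>R x))"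
proof -
  have "(LINT x|lborel. f x) =
      (LINT x|density (distr lborel borel (\<lambda>x. 0 + c *\<^sub>R x)) (\<lambda>_. ennreal (\<bar>c\<bar>^DIM('a))). f x)"
    by (rule arg_cong[where f = "\<lambda>M. integral\<^sup>L M f"], rule lborel_affine, use assms(2) in simp)
  also have "\<dots> = c ^ DIM('a) * (LINT x|lborel. f (c *\<^sub>R x))"
    using assms by (simp add: integral_density integral_distr)
  finally show ?thesis .
qed

lemma lborel_integrable_scaleR_iff:
  fixes f :: "'a::euclidean_space \<Rightarrow> real"
  assumes [measurable]: "f \<in> borel_measurable borel" and "c > 0"
  shows "integrable lborel (\<lambda>x. f (c *\<^sub>R x)) \<longleftrightarrow> integrable lborel f"
proof -
  have "integrable lborel f \<longleftrightarrow>
      integrable (density (distr lborel borel (\<lambda>x. 0 + c *\<^sub>R x)) (\<lambda>_. ennreal (\<bar>c\<bar>^DIM('a)))) f"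
    by (rule arg_cong[where f = "\<lambda>M. integrable M f"], rule lborel_affine, use assms(2) in simp)
  also have "\<dots> \<longleftrightarrow> integrable lborel (\<lambda>x. f (c *\<^sub>R x))"
    using assms by (simp add: integrable_density integrable_distr_eq)
  finally show ?thesis
    by simp
qed

text \<open>Layer-cake in the radial variable: no polar coordinates are available, so
  \<open>\<psi>(|x|)\<close> is written as the integral of the indicator of \<open>|x| < s\<close> against a signed weight.\<close>

lemma integral_radial_weight:
  fixes h :: "'a::euclidean_space \<Rightarrow> real" and w :: "real \<Rightarrow> real"
  assumes [measurable]: "h \<in> borel_measurable borel" "w \<in> borel_measurable borel"
    and homogeneous: "\<And>c x. c > 0 \<Longrightarrow> h (c *\<^sub>R x) = h x"
    and int_h: "integrable lborel (\<lambda>x. indicator (ball 0 1) x * h x)"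
    and int_w: "integrable lborel (\<lambda>s. indicator {0<..} s * (w s * s ^ DIM('a)))"
  shows "(LINT x|lborel. (LINT s|lborel. indicator {norm x<..} s * w s) * h x) =
    (LINT s|lborel. indicator {0<..} s * (w s * s ^ DIM('a))) *
    (LINT x|lborel. indicator (ball 0 1) x * h x)"
proof -
  \<comment> \<open>Stated for a general \<open>k\<close> because it is applied to \<open>h\<close>
    and, for absolute integrability, to the absolute value of \<open>h\<close>.\<close>
  have scale: "(LINT x|lborel. indicator (ball 0 s) x * k x)
      = s ^ DIM('a) * (LINT x|lborel. indicator (ball 0 1) x * k x)"
    if "s > 0" and [measurable]: "k \<in> borel_measurable borel"
      and k: "\<And>c x. c > 0 \<Longrightarrow> k (c *\<^sub>R x) = k x" for s and k :: "'a \<Rightarrow> real"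
  proof -
    have "indicator (ball 0 s) (s *\<^sub>R x) = (indicator (ball 0 1) x :: real)" for x :: 'a
      using \<open>s > 0\<close> by (auto simp: indicator_def)
    moreover have "(\<lambda>x. indicator (ball 0 s) x * k x) \<in> borel_measurable borel"
      by (intro borel_measurable_times borel_measurable_indicator) auto
    ultimately show ?thesis
      by (subst lborel_integral_scaleR[OF _ \<open>s > 0\<close>]) (simp_all add: k \<open>s > 0\<close>)
  qed
  define F where "F = (\<lambda>p::real \<times> 'a. indicator {norm (snd p)<..} (fst p) * w (fst p) * h (snd p))"
  have [measurable]: "F \<in> borel_measurable (lborel \<Otimes>\<^sub>M lborel)"
  proof -
    have "F = (\<lambda>p. if norm (snd p) < fst p then w (fst p) * h (snd p) else 0)"
      by (auto simp: F_def fun_eq_iff)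
    then show ?thesis
      by simp
  qed
  \<comment> \<open>The condition \<open>norm x < s\<close> is a half-line in \<open>s\<close> for
    fixed \<open>x\<close> and a ball in \<open>x\<close> for fixed \<open>s\<close>; the second
    reading forces \<open>s > 0\<close>, which is where the factor \<open>indicator {0<..} s\<close>
    comes from.\<close>
  have F: "F (s, x) = (indicator {0<..} s * w s) * (indicator (ball 0 s) x * h x)" for s x
  proof (cases "norm x < s")
    case True
    then have "0 < s"
      using norm_ge_zero[of x] by linarith
    with True show ?thesis
      by (simp add: F_def)
  qed (auto simp: F_def)
  have absF: "\<bar>F (s, x)\<bar> = (indicator {0<..} s * \<bar>w s\<bar>) * (indicator (ball 0 s) x * \<bar>h x\<bar>)" for s x
    by (simp add: F abs_mult)
  have int_hs: "integrable lborel (\<lambda>x. indicator (ball 0 s) x * h x)" if "s > 0" for s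
  proof -
    have "(\<lambda>x. indicator (ball 0 s) x * h x) \<in> borel_measurable borel"
      by (intro borel_measurable_times borel_measurable_indicator) auto
    note scaled = lborel_integrable_scaleR_iff[OF this that]
    have eq: "indicator (ball 0 s) (s *\<^sub>R x) * h (s *\<^sub>R x) = indicator (ball 0 1) x * h x" for x
      using that by (auto simp: indicator_def homogeneous)
    show ?thesis
      using scaled int_h unfolding eq by blast
  qed
  have inner: "(LINT x|lborel. F (s, x)) = (indicator {0<..} s * (w s * s ^ DIM('a))) *
      (LINT x|lborel. indicator (ball 0 1) x * h x)" for s
    by (cases "s > 0") (simp_all add: F scale[of s h] homogeneous)
  have abs_inner: "(LINT x|lborel. \<bar>F (s, x)\<bar>) = \<bar>indicator {0<..} s * (w s * s ^ DIM('a))\<bar> *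
      (LINT x|lborel. indicator (ball 0 1) x * \<bar>h x\<bar>)" for s
    by (cases "s > 0") (simp_all add: absF scale[of s "\<lambda>x. \<bar>h x\<bar>"] homogeneous abs_mult)
  have "integrable (lborel \<Otimes>\<^sub>M lborel) F"
  proof (rule lborel_pair.Fubini_integrable)
    show "integrable lborel (\<lambda>s. LINT x|lborel. norm (F (s, x)))"
      unfolding real_norm_def abs_inner using int_w by (intro integrable_mult_left integrable_abs)
    show "AE s in lborel. integrable lborel (\<lambda>x. F (s, x))"
    proof (rule AE_I2)
      show "integrable lborel (\<lambda>x. F (s, x))" for s
        by (cases "s > 0") (simp_all add: F int_hs)
    qed
  qed simp
  then have int': "integrable (lborel \<Otimes>\<^sub>M lborel) (case_prod (\<lambda>s x. F (s, x)))"
    by simp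
  have "(LINT x|lborel. (LINT s|lborel. indicator {norm x<..} s * w s) * h x) =
      (LINT x|lborel. (LINT s|lborel. F (s, x)))"
    by (simp add: F_def)
  also have "\<dots> = (LINT s|lborel. (LINT x|lborel. F (s, x)))"
    by (rule lborel_pair.Fubini_integral[OF int'])
  also have "\<dots> = (LINT s|lborel. indicator {0<..} s * (w s * s ^ DIM('a))) *
    (LINT x|lborel. indicator (ball 0 1) x * h x)"
    unfolding inner by simp
  finally show ?thesis .
qed

section \<open>Gaussian integrals of monomials\<close>

lemma has_bochner_integral_gaussian_power:
  "has_bochner_integral lborel (\<lambda>x::real. exp (- x\<^sup>2) * x ^ k)
    (if even k then sqrt pi * (fact k / (2 ^ k * fact (k div 2))) else 0)"
proof (cases "even k")
  case True
  then obtain j where k: "k = 2 * j"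
    by (elim evenE)
  show ?thesis
    using has_bochner_integral_even_function[OF gaussian_moment_even_pos[of j]] by (simp add: k)
next
  case False
  then obtain j where k: "k = 2 * j + 1"
    by (elim oddE)
  show ?thesis
    using has_bochner_integral_odd_function[OF gaussian_moment_odd_pos[of j]] by (simp add: k)
qed

text \<open>The Gaussian factors over the coordinates and Lebesgue measure is the image of a product
  measure, so the integral is a product of one-dimensional moments.\<close>

lemma has_bochner_integral_gaussian_monomial:
  fixes a :: "'a::euclidean_space \<Rightarrow> nat"
  shows "has_bochner_integral lborel
    (\<lambda>x::'a. exp (- (norm x)\<^sup>2) * (\<Prod>b\<in>Basis. (x \<bullet> b) ^ a b))
    (\<Prod>b\<in>Basis. if even (a b) then sqrt pi * (fact (a b) / (2 ^ a b * fact (a b div 2))) else 0)"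
proof -
  interpret product_sigma_finite "\<lambda>b::'a. lborel :: real measure" ..
  define g :: "'a \<Rightarrow> real \<Rightarrow> real" where "g = (\<lambda>b x. exp (- x\<^sup>2) * x ^ a b)"
  define c :: "'a \<Rightarrow> real" where
    "c = (\<lambda>b. if even (a b) then sqrt pi * (fact (a b) / (2 ^ a b * fact (a b div 2))) else 0)"
  have g: "has_bochner_integral lborel (g b) (c b)" for b
    unfolding g_def c_def by (rule has_bochner_integral_gaussian_power)
  have eq: "exp (- (norm x)\<^sup>2) * (\<Prod>b\<in>Basis. (x \<bullet> b) ^ a b) = (\<Prod>b\<in>Basis. g b (x \<bullet> b))" for x :: 'a
    unfolding g_def prod.distrib exp_sum[OF finite_Basis, symmetric] sum_negf power2_norm_eq_inner
      euclidean_inner[of x x] by (simp add: power2_eq_square)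
  have [measurable]: "g b \<in> borel_measurable borel" for b
    unfolding g_def by measurable
  have M: "(\<lambda>x::'a. \<Prod>b\<in>Basis. g b (x \<bullet> b)) \<in> borel_measurable borel"
    by measurable
  have S: "(\<lambda>f. \<Sum>b\<in>Basis. f b *\<^sub>R b) \<in> measurable (\<Pi>\<^sub>M b\<in>(Basis::'a set). lborel) (borel::'a measure)"
    by measurable
  have "has_bochner_integral (\<Pi>\<^sub>M b\<in>(Basis::'a set). lborel) (\<lambda>f. \<Prod>b\<in>Basis. g b (f b)) (\<Prod>b\<in>Basis. c b)"
    using g by (auto simp: has_bochner_integral_iff intro!: product_integrable_prod product_integral_prod[THEN trans])
  then show ?thesis
    unfolding eq c_def[symmetric]
    by (subst lborel_eq, subst has_bochner_integral_iff, subst integrable_distr_eq[OF S M],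
        subst integral_distr[OF S M]) (simp add: has_bochner_integral_iff)
qed

text \<open>The weight is minus the derivative of \<open>s^k exp(-s^2)\<close>, which vanishes at
  infinity. This is the signed weight whose tail integrals reproduce the radial profile of a
  Gaussian times a homogeneous function. For \<open>k = 0\<close> the truncated exponent
  \<open>k - 1\<close> is harmless, as its coefficient is zero.\<close>

lemma has_bochner_integral_power_gaussian_tail:
  fixes r :: real
  assumes "r \<ge> 0"
  shows "has_bochner_integral lborel
    (\<lambda>s. indicator {r<..} s * ((2 * s ^ (k + 1) - k * s ^ (k - 1)) * exp (- s\<^sup>2))) (r ^ k * exp (- r\<^sup>2))"
proof -
  let ?w = "\<lambda>s::real. (2 * s ^ (k + 1) - k * s ^ (k - 1)) * exp (- s\<^sup>2)"
  have pow: "integrable lborel (\<lambda>s::real. exp (- s\<^sup>2) * s ^ j)" for j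
    using has_bochner_integral_gaussian_power[of j] by (simp add: has_bochner_integral_iff)
  have "integrable lborel (\<lambda>s. 2 * (exp (- s\<^sup>2) * s ^ (k + 1)) - k * (exp (- s\<^sup>2) * s ^ (k - 1)))"
    by (intro Bochner_Integration.integrable_diff integrable_mult_right pow)
  also have "(\<lambda>s. 2 * (exp (- s\<^sup>2) * s ^ (k + 1)) - k * (exp (- s\<^sup>2) * s ^ (k - 1))) = ?w"
    by (simp add: fun_eq_iff algebra_simps)
  finally have int_w: "integrable lborel ?w" .
  then have int: "set_integrable lborel {r<..} ?w"
    unfolding set_integrable_def by (intro integrable_mult_indicator) simp_all
  have e: "einterval (ereal r) \<infinity> = {r<..}"
    by (auto simp: einterval_def)
  have "(LBINT s=ereal r..\<infinity>. ?w s) = 0 - (- (r ^ k * exp (- r\<^sup>2)))"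
  proof (rule interval_integral_FTC_integrable)
    show "((\<lambda>s. - (s ^ k * exp (- s\<^sup>2))) has_vector_derivative ?w s) (at s)" for s
      unfolding has_real_derivative_iff_has_vector_derivative[symmetric]
      by (auto intro!: derivative_eq_intros simp: algebra_simps)
    show "(((\<lambda>s. - (s ^ k * exp (- s\<^sup>2))) \<circ> real_of_ereal) \<longlongrightarrow> - (r ^ k * exp (- r\<^sup>2))) (at_right (ereal r))"
      unfolding ereal_tendsto_simps
      by (intro tendsto_intros)
    show "(((\<lambda>s. - (s ^ k * exp (- s\<^sup>2))) \<circ> real_of_ereal) \<longlongrightarrow> 0) (at_left \<infinity>)"
      unfolding ereal_tendsto_simps
      by real_asymp
  qed (use int e in \<open>auto intro!: continuous_intros\<close>)
  then have "(LINT s|lborel. indicator {r<..} s * ?w s) = r ^ k * exp (- r\<^sup>2)"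
    by (simp add: interval_lebesgue_integral_def e set_lebesgue_integral_def)
  with int show ?thesis
    by (simp add: has_bochner_integral_iff set_integrable_def)
qed

text \<open>The same ball integral is compared with the Gaussian integral and with the sphere
  integral. Write \<open>p x = |x|^(2m) h x\<close> with \<open>h\<close> constant along rays: the
  Gaussian integral is \<open>2 (m+1)!\<close> times the ball integral of \<open>h\<close>, and the
  sphere integral is 4 times it.\<close>

lemma has_bochner_integral_sphere_homogeneous:
  fixes p :: "real^4 \<Rightarrow> real"
  assumes [measurable]: "p \<in> borel_measurable borel"
    and homogeneous: "\<And>c x. c \<ge> 0 \<Longrightarrow> p (c *\<^sub>R x) = c ^ (2 * m) * p x"
    and bound: "\<And>x. norm x \<le> 1 \<Longrightarrow> \<bar>p x\<bar> \<le> C"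
  shows "has_bochner_integral surface_measure p
    (2 / fact (m + 1) * (LINT x|lborel. exp (- (norm x)\<^sup>2) * p x))"
proof -
  define h where "h = (\<lambda>x. p (x /\<^sub>R norm x))"
  define w :: "real \<Rightarrow> real" where
    "w = (\<lambda>s. (2 * s ^ (2 * m + 1) - real (2 * m) * s ^ (2 * m - 1)) * exp (- s\<^sup>2))"
  have [measurable]: "h \<in> borel_measurable borel" "w \<in> borel_measurable borel"
    unfolding h_def w_def by measurable
  have h_scale: "h (c *\<^sub>R x) = h x" if "c > 0" for c x
    using that by (simp add: h_def mult.commute[of "inverse c"] mult.assoc)
  have h_le: "\<bar>h x\<bar> \<le> C" for x
    unfolding h_def by (rule bound) (simp add: divide_simps)
  have int_h: "integrable lborel (\<lambda>x. indicator A x * h x)" if "A \<subseteq> ball 0 1" "A \<in> sets borel" for A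
  proof -
    have "integrable lborel (\<lambda>x. indicator A x *\<^sub>R h x)"
    proof (rule integrableI_bounded_set_indicator)
      have "emeasure lborel A \<le> emeasure lborel (ball (0::real^4) 1)"
        using that by (intro emeasure_mono) auto
      also have "\<dots> < \<infinity>"
        by (rule emeasure_bounded_finite) simp
      finally show "emeasure lborel A < \<infinity>" .
      show "AE x in lborel. x \<in> A \<longrightarrow> norm (h x) \<le> C"
        by (simp add: h_le)
    qed (use that in simp_all)
    then show ?thesis
      by simp
  qed
  \<comment> \<open>The half-line moments of \<open>s^(2m+5)\<close> and \<open>s^(2m+3)\<close>
    give \<open>(m+2)! - m (m+1)! = 2 (m+1)!\<close>.\<close>
  have w_s: "has_bochner_integral lborel (\<lambda>s. indicator {0<..} s * (w s * s ^ 4)) (2 * fact (m + 1))"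
  proof -
    have "has_bochner_integral lborel (\<lambda>s::real.
        2 * (indicator {0..} s *\<^sub>R (exp (- s\<^sup>2) * s ^ (2 * (m + 2) + 1))) -
        real (2 * m) * (indicator {0..} s *\<^sub>R (exp (- s\<^sup>2) * s ^ (2 * (m + 1) + 1))))
        (2 * (fact (m + 2) / 2) - real (2 * m) * (fact (m + 1) / 2))"
      by (intro has_bochner_integral_diff has_bochner_integral_mult_right gaussian_moment_odd_pos)
    also have "(\<lambda>s::real.
        2 * (indicator {0..} s *\<^sub>R (exp (- s\<^sup>2) * s ^ (2 * (m + 2) + 1))) -
        real (2 * m) * (indicator {0..} s *\<^sub>R (exp (- s\<^sup>2) * s ^ (2 * (m + 1) + 1)))) =
        (\<lambda>s. indicator {0<..} s * (w s * s ^ 4))"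
    proof
      fix s :: real
      show "2 * (indicator {0..} s *\<^sub>R (exp (- s\<^sup>2) * s ^ (2 * (m + 2) + 1))) -
        real (2 * m) * (indicator {0..} s *\<^sub>R (exp (- s\<^sup>2) * s ^ (2 * (m + 1) + 1))) =
        indicator {0<..} s * (w s * s ^ 4)"
        \<comment> \<open>The case \<open>m = 0\<close> isolates the truncated exponent
          \<open>2 * m - 1\<close>; the case \<open>s = 0\<close> is the only point where the closed
          and the open half-line differ.\<close>
        by (cases m; cases "s = 0")
          (auto simp: w_def indicator_def algebra_simps power_add eval_nat_numeral)
    qed
    also have "2 * (fact (m + 2) / 2) - real (2 * m) * (fact (m + 1) / 2) = (2 * fact (m + 1) :: real)"
      by (simp add: algebra_simps)
    finally show ?thesis .
  qed
  have "(LINT x|lborel. exp (- (norm x)\<^sup>2) * p x) =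
      (LINT x|lborel. (LINT s|lborel. indicator {norm x<..} s * w s) * h x)"
  proof (rule Bochner_Integration.integral_cong)
    fix x :: "real^4"
    have "p x = p (norm x *\<^sub>R (x /\<^sub>R norm x))"
      by (cases "x = 0") simp_all
    also have "\<dots> = norm x ^ (2 * m) * h x"
      unfolding h_def by (rule homogeneous) simp
    finally show "exp (- (norm x)\<^sup>2) * p x = (LINT s|lborel. indicator {norm x<..} s * w s) * h x"
      using has_bochner_integral_power_gaussian_tail[of "norm x" "2 * m"]
      by (simp add: has_bochner_integral_iff w_def)
  qed simp
  also have "\<dots> = 2 * fact (m + 1) * (LINT x|lborel. indicator (ball 0 1) x * h x)"
    using w_s int_h[of "ball 0 1"]
    by (subst integral_radial_weight) (simp_all add: has_bochner_integral_iff h_scale)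
  also have "(LINT x|lborel. indicator (ball 0 1) x * h x) =
      (LINT x|lborel. indicator (ball 0 1 - {0}) x * h x)"
    using AE_lborel_singleton[of "0::real^4"]
    by (intro integral_cong_AE) (auto simp: indicator_def)
  finally have "2 / fact (m + 1) * (LINT x|lborel. exp (- (norm x)\<^sup>2) * p x) =
      4 * (LINT x|lborel. indicator (ball 0 1 - {0}) x * h x)"
    by (simp del: fact_Suc)
  then show ?thesis
    using integral_surface_measure[of p] int_h[of "ball 0 1 - {0}"]
    by (simp add: has_bochner_integral_iff h_def del: fact_Suc)
qed

text \<open>Exponents form a tuple so that multiplying monomials is componentwise addition of
  tuples.\<close>

definition monomial4 :: "nat \<times> nat \<times> nat \<times> nat \<Rightarrow> real^4 \<Rightarrow> real" where
  "monomial4 = (\<lambda>(a, b, c, d) u. u$1 ^ a * u$2 ^ b * u$3 ^ c * u$4 ^ d)"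

text \<open>The moment of \<open>x^k\<close> against \<open>exp(-x^2)\<close>, divided by
  \<open>sqrt pi\<close>. The four factors \<open>sqrt pi\<close> are collected as
  \<open>pi^2\<close>, so that everything left is rational.\<close>

definition gauss_moment :: "nat \<Rightarrow> real" where
  "gauss_moment k = (if even k then fact k / (2 ^ k * fact (k div 2)) else 0)"

definition sphere_moment :: "nat \<times> nat \<times> nat \<times> nat \<Rightarrow> real" where
  "sphere_moment = (\<lambda>(a, b, c, d). 2 / fact ((a + b + c + d) div 2 + 1) *
    (gauss_moment a * gauss_moment b * gauss_moment c * gauss_moment d))"

lemma prod_4: "prod f (UNIV :: 4 set) = f 1 * f 2 * f 3 * f 4"
  unfolding UNIV_4 by (simp add: ac_simps)

lemma prod_Basis_vec: "(\<Prod>b\<in>(Basis :: (real^'n) set). f b) = (\<Prod>i\<in>UNIV. f (axis i 1))"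
proof -
  have "(Basis :: (real^'n) set) = (\<lambda>i. axis i 1) ` UNIV"
    by (auto simp: Basis_vec_def)
  moreover have "inj (\<lambda>i::'n. axis i (1::real))"
    by (simp add: inj_def axis_eq_axis)
  ultimately show ?thesis
    by (metis (no_types, lifting) prod.reindex_cong)
qed

lemma has_bochner_integral_monomial4:
  assumes "even (a + b + c + d)"
  shows "has_bochner_integral surface_measure (monomial4 (a, b, c, d)) (pi\<^sup>2 * sphere_moment (a, b, c, d))"
proof -
  define e :: "4 \<Rightarrow> nat" where "e = (\<lambda>i. if i = 1 then a else if i = 2 then b else if i = 3 then c else d)"
  obtain m where m: "a + b + c + d = 2 * m"
    using assms by (elim evenE)
  have p: "monomial4 (a, b, c, d) x = (\<Prod>i\<in>UNIV. (x $ i) ^ e i)" for x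
    by (simp add: monomial4_def prod_4 e_def)
  have "(LINT x|lborel. exp (- (norm x)\<^sup>2) * monomial4 (a, b, c, d) x) =
      (LINT x::real^4|lborel. exp (- (norm x)\<^sup>2) * (\<Prod>b\<in>Basis. (x \<bullet> b) ^ e (axis_index b)))"
    by (simp add: prod_Basis_vec p axis_index_axis inner_axis)
  also have "\<dots> = (\<Prod>i\<in>UNIV. sqrt pi * gauss_moment (e i))"
    using has_bochner_integral_gaussian_monomial[of "\<lambda>b::real^4. e (axis_index b)"]
    by (auto simp: prod_Basis_vec axis_index_axis has_bochner_integral_iff gauss_moment_def intro!: prod.cong)
  also have "\<dots> = pi\<^sup>2 * (gauss_moment a * gauss_moment b * gauss_moment c * gauss_moment d)"
  proof -
    have "sqrt pi * sqrt pi * (sqrt pi * sqrt pi) = pi\<^sup>2"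
      by (simp add: power2_eq_square)
    then show ?thesis
      unfolding prod_4 e_def by (simp add: algebra_simps)
  qed
  finally have gauss: "(LINT x|lborel. exp (- (norm x)\<^sup>2) * monomial4 (a, b, c, d) x) = \<dots>" .
  have "has_bochner_integral surface_measure (monomial4 (a, b, c, d))
    (2 / fact (m + 1) * (LINT x|lborel. exp (- (norm x)\<^sup>2) * monomial4 (a, b, c, d) x))"
  proof (rule has_bochner_integral_sphere_homogeneous)
    show "monomial4 (a, b, c, d) (r *\<^sub>R x) = r ^ (2 * m) * monomial4 (a, b, c, d) x" for r x
      unfolding m[symmetric] by (simp add: monomial4_def power_mult_distrib power_add)
    show "\<bar>monomial4 (a, b, c, d) x\<bar> \<le> 1" if "norm x \<le> 1" for x
    proof -
      have "\<bar>x $ i\<bar> ^ k \<le> 1" for i k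
        using component_le_norm_cart[of x i] that by (intro power_le_one) auto
      then show ?thesis
        by (simp add: monomial4_def abs_mult power_abs mult_le_one)
    qed
    show "monomial4 (a, b, c, d) \<in> borel_measurable borel"
      unfolding monomial4_def case_prod_conv by measurable
  qed
  then show ?thesis
    unfolding gauss sphere_moment_def case_prod_conv m by (simp only: ac_simps) simp
qed

lemma has_bochner_integral_polynomial4:
  assumes "\<forall>(x, a, b, c, d)\<in>set ps. even (a + b + c + d)"
  shows "has_bochner_integral surface_measure (\<lambda>u. \<Sum>(x, e)\<leftarrow>ps. x * monomial4 e u)
    (pi\<^sup>2 * (\<Sum>(x, e)\<leftarrow>ps. x * sphere_moment e))"
  using assms
proof (induction ps)
  case Nil
  then show ?case
    by (simp add: has_bochner_integral_zero)
next
  case (Cons p ps)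
  obtain x e where p: "p = (x, e)"
    by (rule prod.exhaust)
  have "has_bochner_integral surface_measure (\<lambda>u. x * monomial4 e u + (\<Sum>(x, e)\<leftarrow>ps. x * monomial4 e u))
    (x * (pi\<^sup>2 * sphere_moment e) + pi\<^sup>2 * (\<Sum>(x, e)\<leftarrow>ps. x * sphere_moment e))"
    using Cons p by (intro has_bochner_integral_add has_bochner_integral_mult_right)
      (cases e, auto intro: has_bochner_integral_monomial4)
  then show ?case
    by (simp add: p algebra_simps)
qed

section \<open>Cubic forms and the operator \<open>Q\<close>\<close>

lemma has_derivative_inverse_norm_power:
  fixes u :: "'a::euclidean_space"
  assumes "norm u = 1"
  shows "((\<lambda>x. inverse (norm x) ^ k) has_derivative (\<lambda>v. - real k * (u \<bullet> v))) (at u)"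
proof -
  have "u \<noteq> 0"
    using assms by auto
  then have N: "(norm has_derivative (\<lambda>v. u \<bullet> v)) (at u)"
    using has_derivative_norm[of u] assms by (simp add: sgn_div_norm inner_commute)
  have "((\<lambda>x. inverse (norm x)) has_derivative (\<lambda>v. - (u \<bullet> v))) (at u)"
    using Deriv.has_derivative_inverse[OF _ N] assms \<open>u \<noteq> 0\<close> by simp
  from has_derivative_power[OF this, of k] show ?thesis
    using assms by (simp add: mult_ac)
qed

text \<open>A cubic \<open>P x = T x x x\<close> is handled through its polarization, so that its
  derivatives are again values of \<open>T\<close>. Linearity in one slot and the two transpositions
  give full symmetry and trilinearity.\<close>

locale cubic_form =
  fixes T :: "'a::euclidean_space \<Rightarrow> 'a \<Rightarrow> 'a \<Rightarrow> real"
  assumes linear: "linear (\<lambda>x. T x y z)"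
    and commute12: "T x y z = T y x z"
    and commute23: "T x y z = T x z y"
begin

lemma rotate: "T x y z = T z x y"
  using commute12[of x z y] commute23[of x y z] by simp

lemma add: "T (x + x') y z = T x y z + T x' y z" "T x (y + y') z = T x y z + T x y' z"
    "T x y (z + z') = T x y z + T x y z'"
  using linear_add[OF linear] commute12 commute23 by metis+

lemma scale: "T (c *\<^sub>R x) y z = c * T x y z" "T x (c *\<^sub>R y) z = c * T x y z"
    "T x y (c *\<^sub>R z) = c * T x y z"
  using linear_scale[OF linear] commute12 commute23 by (metis real_scaleR_def)+

lemma uminus: "T (- x) y z = - T x y z" "T x (- y) z = - T x y z" "T x y (- z) = - T x y z"
  using scale(1)[where c = "-1"] scale(2)[where c = "-1"] scale(3)[where c = "-1"] by simp_all

lemma bounded_bilinear: "bounded_bilinear (T x)"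
  by (rule bilinear_conv_bounded_bilinear[THEN iffD1])
    (auto simp: bilinear_def intro!: linearI simp: add scale)

lemma basis_expansion: "T x y z = (\<Sum>b\<in>Basis. (x \<bullet> b) * T b y z)"
proof -
  have "T x y z = T (\<Sum>b\<in>Basis. (x \<bullet> b) *\<^sub>R b) y z"
    by (simp add: euclidean_representation)
  also have "\<dots> = (\<Sum>b\<in>Basis. (x \<bullet> b) * T b y z)"
    by (simp add: linear_sum[OF linear] scale)
  finally show ?thesis .
qed

lemma bounded: obtains B where "B > 0" "\<And>x y z. \<bar>T x y z\<bar> \<le> B * norm x * norm y * norm z"
proof -
  have "\<exists>K. \<forall>y z. \<bar>T b y z\<bar> \<le> norm y * norm z * K" for b
    using bounded_bilinear.bounded[OF bounded_bilinear, of b] by simp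
  then obtain K where K: "\<bar>T b y z\<bar> \<le> norm y * norm z * K b" for b y z
    by metis
  define B where "B = 1 + (\<Sum>b\<in>Basis. \<bar>K b\<bar>)"
  have "\<bar>T x y z\<bar> \<le> B * norm x * norm y * norm z" for x y z
  proof -
    have "\<bar>T x y z\<bar> \<le> (\<Sum>b\<in>Basis. \<bar>(x \<bullet> b) * T b y z\<bar>)"
      unfolding basis_expansion[of x] by (rule sum_abs)
    also have "\<dots> \<le> (\<Sum>b\<in>Basis. norm x * (norm y * norm z * \<bar>K b\<bar>))"
    proof (rule sum_mono)
      fix b :: 'a assume "b \<in> Basis"
      have "\<bar>T b y z\<bar> \<le> norm y * norm z * \<bar>K b\<bar>"
        using K[of b y z] by (rule order_trans) (simp add: mult_left_mono)
      then show "\<bar>(x \<bullet> b) * T b y z\<bar> \<le> norm x * (norm y * norm z * \<bar>K b\<bar>)"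
        unfolding abs_mult using Basis_le_norm[OF \<open>b \<in> Basis\<close>] by (intro mult_mono) auto
    qed
    also have "\<dots> = (\<Sum>b\<in>Basis. \<bar>K b\<bar>) * norm x * norm y * norm z"
      by (simp add: sum_distrib_left sum_distrib_right mult_ac)
    also have "\<dots> \<le> B * norm x * norm y * norm z"
      unfolding B_def by (intro mult_right_mono) auto
    finally show ?thesis .
  qed
  moreover have "B > 0"
    unfolding B_def by (simp add: add_pos_nonneg sum_nonneg)
  ultimately show thesis
    using that by blast
qed

text \<open>Expanding one slot in the basis leaves products of a coordinate and a bilinear form, to
  which the product rules apply; symmetry merges the three resulting terms.\<close>

lemma has_derivative_diag [derivative_intros]:
  assumes "(f has_derivative f') (at x within S)"
  shows "((\<lambda>x. T (f x) (f x) (f x)) has_derivative (\<lambda>h. 3 * T (f x) (f x) (f' h))) (at x within S)"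
proof -
  have "((\<lambda>x. \<Sum>b\<in>Basis. (f x \<bullet> b) * T b (f x) (f x)) has_derivative
     (\<lambda>h. \<Sum>b\<in>Basis. (f x \<bullet> b) * (T b (f x) (f' h) + T b (f' h) (f x)) + (f' h \<bullet> b) * T b (f x) (f x)))
     (at x within S)"
    by (intro derivative_intros bounded_bilinear.FDERIV[OF bounded_bilinear] assms)
  also have "(\<lambda>h. \<Sum>b\<in>Basis. (f x \<bullet> b) * (T b (f x) (f' h) + T b (f' h) (f x)) + (f' h \<bullet> b) * T b (f x) (f x))
      = (\<lambda>h. 3 * T (f x) (f x) (f' h))"
  proof
    fix h
    have "(\<Sum>b\<in>Basis. (f x \<bullet> b) * (T b (f x) (f' h) + T b (f' h) (f x)) + (f' h \<bullet> b) * T b (f x) (f x)) =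
        T (f x) (f x) (f' h) + T (f x) (f' h) (f x) + T (f' h) (f x) (f x)"
      unfolding sum.distrib distrib_left basis_expansion[symmetric] ..
    also have "\<dots> = 3 * T (f x) (f x) (f' h)"
      using commute23[of "f x" "f' h" "f x"] rotate[of "f x" "f x" "f' h"] by simp
    finally show "(\<Sum>b\<in>Basis. (f x \<bullet> b) * (T b (f x) (f' h) + T b (f' h) (f x)) + (f' h \<bullet> b) * T b (f x) (f x)) =
        3 * T (f x) (f x) (f' h)" .
  qed
  finally show ?thesis
    unfolding basis_expansion[symmetric] .
qed

text \<open>The Riesz representative of \<open>T x y\<close>: for \<open>P x = T x x x\<close>, the gradient is \<open>3 T\<^sup>\<sharp> x x\<close> and the Hessian
  applied to \<open>v\<close> is \<open>6 T\<^sup>\<sharp> x v\<close>.\<close>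

definition sharp :: "'a \<Rightarrow> 'a \<Rightarrow> 'a" where
  "sharp x y = (\<Sum>b\<in>Basis. T x y b *\<^sub>R b)"

lemma inner_sharp: "sharp x y \<bullet> z = T x y z"
proof -
  have "sharp x y \<bullet> z = (\<Sum>b\<in>Basis. (z \<bullet> b) * T b x y)"
    by (simp add: sharp_def inner_sum_left rotate[of x y] inner_commute[of z] mult.commute)
  also have "\<dots> = T x y z"
    unfolding basis_expansion[symmetric] by (rule rotate[symmetric])
  finally show ?thesis .
qed

lemma bounded_bilinear_sharp: "bounded_bilinear sharp"
proof -
  have "bilinear sharp"
    by (auto simp: bilinear_def sharp_def add scale scaleR_left_distrib sum.distrib scaleR_sum_right intro!: linearI)
  then show ?thesis
    by (rule bilinear_conv_bounded_bilinear[THEN iffD1])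
qed

lemma sharp_commute: "sharp x y = sharp y x"
  by (simp add: sharp_def commute12[of x y])

lemma radial_ext_eq:
  assumes f: "\<And>u. norm u = 1 \<Longrightarrow> f u = T u u u" and "x \<noteq> 0"
  shows "radial_ext f x = T x x x * inverse (norm x) ^ 3"
proof -
  have "norm (x /\<^sub>R norm x) = 1"
    using assms by simp
  then show ?thesis
    unfolding radial_ext_def f[OF \<open>norm (x /\<^sub>R norm x) = 1\<close>] by (simp add: scale power3_eq_cube)
qed

lemma frechet_derivative_radial_ext:
  assumes f: "\<And>u. norm u = 1 \<Longrightarrow> f u = T u u u" and u: "norm u = 1"
  shows "frechet_derivative (radial_ext f) (at u) = (\<lambda>v. 3 * T u u v - 3 * T u u u * (u \<bullet> v))"
proof -
  have "u \<noteq> 0"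
    using u by auto
  have "((\<lambda>x. T x x x * inverse (norm x) ^ 3) has_derivative (\<lambda>v. 3 * T u u v - 3 * T u u u * (u \<bullet> v))) (at u)"
    by (rule derivative_eq_intros has_derivative_inverse_norm_power[OF u] refl)+ (simp add: fun_eq_iff u)
  then have "(radial_ext f has_derivative (\<lambda>v. 3 * T u u v - 3 * T u u u * (u \<bullet> v))) (at u)"
    by (rule has_derivative_transform_within_open[where s = "- {0}"])
      (use \<open>u \<noteq> 0\<close> radial_ext_eq[OF f] in \<open>auto simp: open_Compl\<close>)
  then show ?thesis
    by (simp add: frechet_derivative_at[symmetric])
qed

lemma sphere_grad_eq:
  assumes f: "\<And>u. norm u = 1 \<Longrightarrow> f u = T u u u" and u: "norm u = 1"
  shows "sphere_grad f u = 3 *\<^sub>R sharp u u - (3 * T u u u) *\<^sub>R u"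
proof (rule euclidean_eqI)
  fix b :: 'a assume "b \<in> Basis"
  then show "sphere_grad f u \<bullet> b = (3 *\<^sub>R sharp u u - (3 * T u u u) *\<^sub>R u) \<bullet> b"
    using frechet_derivative_radial_ext[OF f u]
    by (simp add: sphere_grad_def inner_diff_left inner_sharp)
qed

text \<open>On the sphere the covariant Hessian of \<open>P\<close> is the tangential Euclidean
  Hessian \<open>6 T u\<close> minus the radial derivative \<open>3 P\<close> times the identity;
  adding \<open>P\<close> times the identity leaves the coefficient -2.\<close>

lemma inner_Q_op:
  assumes f: "\<And>u. norm u = 1 \<Longrightarrow> f u = T u u u"
    and u: "norm u = 1" "v \<bullet> u = 0" "w \<bullet> u = 0"
  shows "w \<bullet> Q_op f u v = 6 * T u v w - 2 * T u u u * (v \<bullet> w)"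
proof -
  \<comment> \<open>\<open>?G\<close> is the gradient field extended constantly along rays; the
    powers of the norm bring both terms to degree 0. \<open>?D\<close> is its derivative at
    \<open>u\<close>. Pairing with a tangent \<open>w\<close> kills the multiples of
    \<open>u\<close>, and \<open>u \<bullet> v = 0\<close> kills the terms from differentiating the
    norm.\<close>
  let ?G = "\<lambda>x. (3 * inverse (norm x) ^ 2) *\<^sub>R sharp x x - (3 * T x x x * inverse (norm x) ^ 4) *\<^sub>R x"
  let ?D = "\<lambda>v. 6 *\<^sub>R sharp u v - (6 * (u \<bullet> v)) *\<^sub>R sharp u u - (9 * T u u v - 12 * T u u u * (u \<bullet> v)) *\<^sub>R u
     - (3 * T u u u) *\<^sub>R v"
  have "u \<noteq> 0"
    using u by auto
  have G: "radial_ext (sphere_grad f) x = ?G x" if "x \<noteq> 0" for x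
  proof -
    have "norm (x /\<^sub>R norm x) = 1"
      using that by simp
    then show ?thesis
      unfolding radial_ext_def by (subst sphere_grad_eq[OF f])
        (simp_all add: scale sharp_def scaleR_sum_right power2_eq_square eval_nat_numeral mult_ac)
  qed
  have six: "3 *\<^sub>R x + 3 *\<^sub>R x = 6 *\<^sub>R x" for x :: 'a
    by (metis numeral_Bit0 scaleR_left_distrib)
  have "(?G has_derivative ?D) (at u)"
    by (rule has_derivative_inverse_norm_power[OF u(1)] bounded_bilinear.FDERIV[OF bounded_bilinear_sharp]
          derivative_eq_intros refl)+
       (simp add: fun_eq_iff u algebra_simps sharp_commute six)
  then have "(radial_ext (sphere_grad f) has_derivative ?D) (at u)"
    by (rule has_derivative_transform_within_open[where s = "- {0}"])
      (use \<open>u \<noteq> 0\<close> G in \<open>auto simp: open_Compl\<close>)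
  then have "frechet_derivative (radial_ext (sphere_grad f)) (at u) = ?D"
    by (simp add: frechet_derivative_at[symmetric])
  moreover have "w \<bullet> sharp x y = T x y w" for x y
    using inner_sharp[of x y w] by (simp add: inner_commute)
  moreover have "u \<bullet> v = 0"
    using u by (simp add: inner_commute)
  ultimately show ?thesis
    using u by (simp add: Q_op_def covariant_hessian_def covariant_deriv_def tangent_proj_def f
        inner_diff_right inner_add_right inner_commute[of w v])
qed

end

lemma radial_ext_const: "radial_ext (\<lambda>_. c) = (\<lambda>_. c)"
  by (simp add: fun_eq_iff radial_ext_def)

lemma Q_op_const:
  fixes u v :: "'a::euclidean_space"
  shows "Q_op (\<lambda>_. c) u v = c *\<^sub>R v"
proof -
  have "sphere_grad (\<lambda>_::'a. c) = (\<lambda>_. 0)"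
    by (simp add: fun_eq_iff sphere_grad_def radial_ext_const)
  then show ?thesis
    by (simp add: Q_op_def covariant_hessian_def covariant_deriv_def tangent_proj_def radial_ext_const)
qed

section \<open>Determinants in the quaternionic frame\<close>

text \<open>The quaternion products \<open>i u\<close>, \<open>j u\<close>, \<open>k u\<close> for
  \<open>u = u$1 + u$2 i + u$3 j + u$4 k\<close>: a global tangent frame whose entries are linear in
  \<open>u\<close>, so matrix entries of a cubic stay polynomial.\<close>

definition quaternion_frame :: "real^4 \<Rightarrow> (real^4)^3" where
  "quaternion_frame u = vector [vector [- u$2, u$1, - u$4, u$3], vector [- u$3, u$4, u$1, - u$2],
     vector [- u$4, - u$3, u$2, u$1]]"

lemma quaternion_frame_nth:
  "quaternion_frame u $ 1 = vector [- u$2, u$1, - u$4, u$3]"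
  "quaternion_frame u $ 2 = vector [- u$3, u$4, u$1, - u$2]"
  "quaternion_frame u $ 3 = vector [- u$4, - u$3, u$2, u$1]"
  by (simp_all add: quaternion_frame_def)

lemma vector_4 [simp]:
  "(vector [a, b, c, d] :: ('a::zero)^4) $ 1 = a" "(vector [a, b, c, d] :: ('a::zero)^4) $ 2 = b"
  "(vector [a, b, c, d] :: ('a::zero)^4) $ 3 = c" "(vector [a, b, c, d] :: ('a::zero)^4) $ 4 = d"
  unfolding vector_def by simp_all

lemma inner_4: "(x :: real^4) \<bullet> y = x$1 * y$1 + x$2 * y$2 + x$3 * y$3 + x$4 * y$4"
  by (simp add: inner_vec_def sum_4)

lemma norm_eq_1_4: "norm (u :: real^4) = 1 \<longleftrightarrow> u$1 * u$1 + u$2 * u$2 + u$3 * u$3 + u$4 * u$4 = 1"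
  unfolding norm_eq_1 inner_4 ..

lemma orthonormal_quaternion_frame:
  assumes "norm u = 1"
  shows "orthonormal_frame u (quaternion_frame u)"
  using assms unfolding norm_eq_1_4
  by (simp add: orthonormal_frame_def forall_3 quaternion_frame_nth inner_4 algebra_simps)

lemma quaternion_frame_expansion:
  assumes "norm u = 1" "x \<bullet> u = 0"
  shows "x = (\<Sum>k\<in>UNIV. (x \<bullet> quaternion_frame u $ k) *\<^sub>R quaternion_frame u $ k)"
proof -
  have u: "u$1 * u$1 + u$2 * u$2 + u$3 * u$3 + u$4 * u$4 = 1"
    "x$1 * u$1 + x$2 * u$2 + x$3 * u$3 + x$4 * u$4 = 0"
    using assms by (simp_all add: norm_eq_1_4 inner_4)
  show ?thesis
    unfolding vec_eq_iff forall_4 sum_3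
    by (simp add: quaternion_frame_nth inner_4, intro conjI; use u in algebra)
qed

text \<open>The frame chosen by \<open>SOME\<close> differs from the quaternion frame by an
  orthogonal matrix \<open>R\<close>, and \<open>det R\<close> enters squared. \<open>B\<close> is a
  bilinear extension of the form of \<open>A\<close> to the whole space; only its agreement with
  \<open>A\<close> on tangent vectors matters.\<close>

lemma tangent_det_eq:
  assumes u: "norm u = 1" and B: "bilinear B"
    and A: "\<And>v w. v \<bullet> u = 0 \<Longrightarrow> w \<bullet> u = 0 \<Longrightarrow> w \<bullet> A v = B w v"
  shows "tangent_det u A = det (\<chi> i j. B (quaternion_frame u $ i) (quaternion_frame u $ j))"
proof -
  let ?q = "quaternion_frame u"
  define e where "e = (SOME e. orthonormal_frame u e)"
  have "orthonormal_frame u e"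
    unfolding e_def by (rule someI[of "orthonormal_frame u"]) (rule orthonormal_quaternion_frame[OF u])
  then have e: "e $ i \<bullet> u = 0" "e $ i \<bullet> e $ j = (if i = j then 1 else 0)" for i j
    by (auto simp: orthonormal_frame_def)
  define R :: "real^3^3" where "R = (\<chi> i k. e $ i \<bullet> ?q $ k)"
  define M :: "real^3^3" where "M = (\<chi> i j. B (?q $ i) (?q $ j))"
  have expand: "e $ i = (\<Sum>k\<in>UNIV. R $ i $ k *\<^sub>R ?q $ k)" for i
    using quaternion_frame_expansion[OF u e(1)[of i]] by (simp add: R_def)
  have "R ** transpose R = mat 1"
  proof -
    have "(\<Sum>k\<in>UNIV. R $ i $ k * R $ j $ k) = e $ i \<bullet> e $ j" for i j
      by (subst (2) expand) (simp add: inner_sum_right R_def mult.commute)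
    then show ?thesis
      by (simp add: vec_eq_iff matrix_matrix_mult_def transpose_def mat_def e)
  qed
  then have "det R * det R = 1"
    by (metis det_I det_mul det_transpose)
  moreover have "tangent_matrix u A = R ** M ** transpose R"
  proof -
    have "e $ i \<bullet> A (e $ j) = (\<Sum>l\<in>UNIV. (\<Sum>k\<in>UNIV. R $ i $ k * M $ k $ l) * R $ j $ l)" for i j
    proof -
      have "e $ i \<bullet> A (e $ j) = B (e $ i) (e $ j)"
        by (rule A) (rule e)+
      also have "\<dots> = B (\<Sum>k\<in>UNIV. R $ i $ k *\<^sub>R ?q $ k) (\<Sum>l\<in>UNIV. R $ j $ l *\<^sub>R ?q $ l)"
        unfolding expand[symmetric] ..
      also have "\<dots> = (\<Sum>l\<in>UNIV. (\<Sum>k\<in>UNIV. R $ i $ k * M $ k $ l) * R $ j $ l)"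
        using B by (simp add: sum_3 M_def bilinear_ladd bilinear_radd bilinear_lmul bilinear_rmul algebra_simps)
      finally show ?thesis .
    qed
    then show ?thesis
      unfolding tangent_matrix_def Let_def e_def[symmetric]
      by (simp add: vec_eq_iff matrix_matrix_mult_def transpose_def)
  qed
  ultimately show ?thesis
    by (simp add: tangent_det_def det_mul M_def mult_ac)
qed

text \<open>The polarization of the harmonic cubic obtained from \<open>q_comb\<close> by
  multiplying the linear term of \<open>f\<close> with \<open>|x|^2\<close>. The divisor 6 is 2 from
  the coefficient of that term times 3 from symmetrizing.\<close>

definition comb_form :: "real \<Rightarrow> real \<Rightarrow> real^4 \<Rightarrow> real^4 \<Rightarrow> real^4 \<Rightarrow> real" where
  "comb_form \<alpha> \<beta> x y z =
     \<alpha> * (x$1 * y$1 * z$1 - (x$1 * (y \<bullet> z) + y$1 * (x \<bullet> z) + z$1 * (x \<bullet> y)) / 6) +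
     \<beta> / 3 * (x$1 * y$1 * z$3 + x$1 * y$3 * z$1 + x$3 * y$1 * z$1
       - (x$2 * y$2 * z$3 + x$2 * y$3 * z$2 + x$3 * y$2 * z$2)
       - (x$1 * y$2 * z$4 + x$1 * y$4 * z$2 + x$2 * y$1 * z$4 + x$2 * y$4 * z$1
         + x$4 * y$1 * z$2 + x$4 * y$2 * z$1))"

interpretation comb: cubic_form "comb_form \<alpha> \<beta>"
proof (rule cubic_form.intro)
  show "linear (\<lambda>x. comb_form \<alpha> \<beta> x y z)" for y z
    by (rule linearI) (simp_all add: comb_form_def inner_add_left field_simps)
  show "comb_form \<alpha> \<beta> x y z = comb_form \<alpha> \<beta> y x z" "comb_form \<alpha> \<beta> x y z = comb_form \<alpha> \<beta> x z y" for x y z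
    by (simp_all add: comb_form_def inner_commute algebra_simps)
qed

lemma q_comb_eq_comb_form: "norm u = 1 \<Longrightarrow> q_comb \<alpha> \<beta> u = comb_form \<alpha> \<beta> u u u"
  by (simp add: q_comb_def cubic_f_def cubic_g_def comb_form_def norm_eq_1 algebra_simps
      power2_eq_square power3_eq_cube)

text \<open>The shift \<open>c\<close> serves both volumes: \<open>c = 0\<close> is the plain
  determinant, and \<open>c = 0, 1, 2\<close> are the values met when \<open>D3\<close> is polarized
  against the identity.\<close>

lemma tangent_det_Q_op:
  assumes f: "\<And>u. norm u = 1 \<Longrightarrow> f u = q_comb \<alpha> \<beta> u" and u: "norm u = 1"
  shows "tangent_det u (\<lambda>v. Q_op f u v + c *\<^sub>R v) =
    det (\<chi> i j. 6 * comb_form \<alpha> \<beta> u (quaternion_frame u $ i) (quaternion_frame u $ j)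
      - (2 * q_comb \<alpha> \<beta> u - c) * (if i = j then 1 else 0))"
proof -
  let ?B = "\<lambda>w v. 6 * comb_form \<alpha> \<beta> u w v - (2 * q_comb \<alpha> \<beta> u - c) * (w \<bullet> v)"
  have "tangent_det u (\<lambda>v. Q_op f u v + c *\<^sub>R v) =
      det (\<chi> i j. ?B (quaternion_frame u $ i) (quaternion_frame u $ j))"
  proof (rule tangent_det_eq[OF u])
    show "bilinear ?B"
      by (auto simp: bilinear_def comb.add comb.scale inner_add_left inner_add_right algebra_simps intro!: linearI)
    show "w \<bullet> (Q_op f u v + c *\<^sub>R v) = ?B w v" if "v \<bullet> u = 0" "w \<bullet> u = 0" for v w
      using comb.inner_Q_op[of f \<alpha> \<beta> u v w] f u that
      by (simp add: q_comb_eq_comb_form inner_add_right inner_commute comb.commute23 algebra_simps)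
  qed
  then show ?thesis
    using orthonormal_quaternion_frame[OF u] by (simp add: orthonormal_frame_def)
qed

lemma D3_Q_op_Id:
  assumes f: "\<And>u. norm u = 1 \<Longrightarrow> f u = q_comb \<alpha> \<beta> u" and u: "norm u = 1"
  shows "D3 u (Q_op f u) (\<lambda>v. v) (\<lambda>v. v) = - 4 * q_comb \<alpha> \<beta> u"
proof -
  define t where "t i j = 6 * comb_form \<alpha> \<beta> u (quaternion_frame u $ i) (quaternion_frame u $ j)" for i j
  define q where "q = q_comb \<alpha> \<beta> u"
  note Q = tangent_det_Q_op[OF f u, folded q_def t_def]
  have id: "tangent_det u (\<lambda>v. c *\<^sub>R v) = c ^ 3" for c
    using orthonormal_quaternion_frame[OF u]
    by (subst tangent_det_eq[OF u, of "\<lambda>w v. c * (w \<bullet> v)"])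
      (auto simp: bilinear_def inner_add_left inner_add_right algebra_simps orthonormal_frame_def det_3
        power3_eq_cube intro!: linearI)
  \<comment> \<open>Harmonicity: the full trace of the Hessian vanishes, so the tangential trace is
    minus the radial entry \<open>6 q\<close>. With the three diagonal terms \<open>-2 q\<close> the
    trace becomes \<open>-12 q\<close>, and \<open>D3\<close> takes a third of it.\<close>
  have tr: "t 1 1 + t 2 2 + t 3 3 = - 6 * q"
    unfolding t_def q_def q_comb_eq_comb_form[OF u]
    by (simp add: comb_form_def quaternion_frame_nth inner_4 field_simps)
  show ?thesis
    using Q[of 0] Q[of 1] Q[of 2] id[of 1] id[of 2] tr
    unfolding D3_def q_def[symmetric]
    by (simp add: det_3 scaleR_2 add.assoc) algebra
qed

section \<open>Polynomials as lists of terms and their sphere integrals\<close>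

definition polynomial4 :: "(real \<times> nat \<times> nat \<times> nat \<times> nat) list \<Rightarrow> real^4 \<Rightarrow> real" where
  "polynomial4 ps u = (\<Sum>(x, e)\<leftarrow>ps. x * monomial4 e u)"

lemma monomial4_add: "monomial4 (e + e') u = monomial4 e u * monomial4 e' u"
  by (cases e; cases e') (simp add: monomial4_def power_add)

lemma polynomial4_mult:
  "polynomial4 ps u * polynomial4 qs u =
    (\<Sum>(x, e)\<leftarrow>concat (map (\<lambda>(x, e). map (\<lambda>(y, e'). (x * y, e + e')) qs) ps). x * monomial4 e u)"
proof (induction ps)
  case (Cons p ps)
  obtain x e where p: "p = (x, e)"
    by (rule prod.exhaust)
  have "(\<Sum>(x, e)\<leftarrow>map (\<lambda>(y, e'). (x * y, e + e')) qs. x * monomial4 e u) = x * monomial4 e u * polynomial4 qs u"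
    by (induction qs) (auto simp: polynomial4_def monomial4_add algebra_simps)
  then show ?case
    using Cons by (simp add: p polynomial4_def distrib_right)
qed (simp add: polynomial4_def)

text \<open>Two factors of odd degree have a product of even degree, where the moment formula
  applies. The integral becomes a double sum over terms, so evaluating it needs no expansion of the
  product as a function.\<close>

lemma sphere_integral_polynomial4_mult:
  assumes "\<forall>(x, a, b, c, d)\<in>set ps. odd (a + b + c + d)" "\<forall>(x, a, b, c, d)\<in>set qs. odd (a + b + c + d)"
  shows "(LINT u|surface_measure. polynomial4 ps u * polynomial4 qs u) =
    pi\<^sup>2 * (\<Sum>(x, e)\<leftarrow>ps. \<Sum>(y, e')\<leftarrow>qs. x * y * sphere_moment (e + e'))"
proof -
  let ?rs = "concat (map (\<lambda>(x, e). map (\<lambda>(y, e'). (x * y, e + e')) qs) ps)"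
  have "\<forall>(x, a, b, c, d)\<in>set ?rs. even (a + b + c + d)"
    using assms by fastforce
  from has_bochner_integral_polynomial4[OF this]
  have "(LINT u|surface_measure. polynomial4 ps u * polynomial4 qs u) = pi\<^sup>2 * (\<Sum>(x, e)\<leftarrow>?rs. x * sphere_moment e)"
    unfolding polynomial4_mult has_bochner_integral_iff by blast
  also have "(\<Sum>(x, e)\<leftarrow>?rs. x * sphere_moment e) =
      (\<Sum>(x, e)\<leftarrow>ps. \<Sum>(y, e')\<leftarrow>qs. x * y * sphere_moment (e + e'))"
  proof (induction ps)
    case (Cons p ps)
    have "(\<Sum>(x, e)\<leftarrow>map (\<lambda>(y, e'). (x * y, e + e')) qs. x * sphere_moment e) =
        (\<Sum>(y, e')\<leftarrow>qs. x * y * sphere_moment (e + e'))" for x e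
      by (induction qs) auto
    with Cons show ?case
      by (cases p) simp
  qed simp
  finally show ?thesis .
qed

text \<open>Exponents reach 12 = 3 + 9, the degrees of \<open>q\<close> and of its determinant. The
  \<open>Suc\<close> forms repeat small values for exponents not written as numerals.\<close>

lemma gauss_moment_values:
  "gauss_moment 0 = 1" "gauss_moment (Suc 0) = 0" "gauss_moment 2 = 1/2" "gauss_moment 3 = 0"
  "gauss_moment (Suc (Suc 0)) = 1/2" "gauss_moment (Suc (Suc (Suc 0))) = 0"
  "gauss_moment 4 = 3/4" "gauss_moment 5 = 0" "gauss_moment 6 = 15/8" "gauss_moment 7 = 0"
  "gauss_moment 8 = 105/16" "gauss_moment 9 = 0" "gauss_moment 10 = 945/32" "gauss_moment 11 = 0"
  "gauss_moment 12 = 10395/64"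
  by (simp_all add: gauss_moment_def fact_numeral)

definition q_terms :: "real \<Rightarrow> real \<Rightarrow> (real \<times> nat \<times> nat \<times> nat \<times> nat) list" where
  "q_terms \<alpha> \<beta> =
    [(\<alpha> / 2, 3, 0, 0, 0), (- \<alpha> / 2, 1, 2, 0, 0), (- \<alpha> / 2, 1, 0, 2, 0), (- \<alpha> / 2, 1, 0, 0, 2),
     (\<beta>, 2, 0, 1, 0), (- \<beta>, 0, 2, 1, 0), (- 2 * \<beta>, 1, 1, 0, 1)]"

text \<open>The expansion of \<open>det Q\<^sub>q\<close> in the quaternionic frame, found by computer algebra; it is homogeneous of
  degree 9 because \<open>q\<close> is represented by the cubic form.\<close>

definition det_terms :: "real \<Rightarrow> real \<Rightarrow> (real \<times> nat \<times> nat \<times> nat \<times> nat) list" where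
  "det_terms \<alpha> \<beta> = [
    (- 8 * \<alpha>^3, 9, 0, 0, 0), (24 * \<alpha>^3, 7, 2, 0, 0), (24 * \<alpha>^3, 7, 0, 2, 0),
    (24 * \<alpha>^3, 7, 0, 0, 2), (- 48 * \<alpha>^2 * \<beta>, 8, 0, 1, 0),
    (48 * \<alpha>^2 * \<beta>, 7, 1, 0, 1), (48 * \<alpha>^2 * \<beta>, 6, 2, 1, 0),
    (72 * \<alpha>^2 * \<beta>, 6, 0, 3, 0), (72 * \<alpha>^2 * \<beta>, 6, 0, 1, 2),
    (- 144 * \<alpha>^2 * \<beta>, 5, 3, 0, 1), (- 144 * \<alpha>^2 * \<beta>, 5, 1, 2, 1),
    (- 144 * \<alpha>^2 * \<beta>, 5, 1, 0, 3), (- 96 * \<alpha>^2 * \<beta>, 4, 4, 1, 0),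
    (- 72 * \<alpha>^2 * \<beta>, 4, 2, 3, 0), (- 72 * \<alpha>^2 * \<beta>, 4, 2, 1, 2),
    (24 * \<alpha>^2 * \<beta>, 4, 0, 5, 0), (48 * \<alpha>^2 * \<beta>, 4, 0, 3, 2),
    (24 * \<alpha>^2 * \<beta>, 4, 0, 1, 4), (8 * \<alpha> * \<beta>^2, 9, 0, 0, 0),
    (24 * \<alpha> * \<beta>^2, 7, 2, 0, 0), (- 96 * \<alpha> * \<beta>^2, 7, 0, 2, 0),
    (288 * \<alpha> * \<beta>^2, 6, 1, 1, 1), (24 * \<alpha> * \<beta>^2, 5, 4, 0, 0),
    (72 * \<alpha> * \<beta>^2, 5, 2, 2, 0), (- 216 * \<alpha> * \<beta>^2, 5, 2, 0, 2),
    (- 192 * \<alpha> * \<beta>^2, 4, 3, 1, 1), (- 96 * \<alpha> * \<beta>^2, 4, 1, 3, 1),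
    (- 96 * \<alpha> * \<beta>^2, 4, 1, 1, 3), (8 * \<alpha> * \<beta>^2, 3, 6, 0, 0),
    (- 144 * \<alpha> * \<beta>^2, 3, 4, 2, 0), (144 * \<alpha> * \<beta>^2, 3, 4, 0, 2),
    (- 144 * \<alpha> * \<beta>^2, 3, 2, 4, 0), (144 * \<alpha> * \<beta>^2, 3, 2, 0, 4),
    (8 * \<alpha> * \<beta>^2, 3, 0, 6, 0), (24 * \<alpha> * \<beta>^2, 3, 0, 4, 2),
    (24 * \<alpha> * \<beta>^2, 3, 0, 2, 4), (8 * \<alpha> * \<beta>^2, 3, 0, 0, 6),
    (288 * \<alpha> * \<beta>^2, 2, 5, 1, 1), (288 * \<alpha> * \<beta>^2, 2, 3, 3, 1),
    (288 * \<alpha> * \<beta>^2, 2, 3, 1, 3), (72 * \<alpha> * \<beta>^2, 1, 6, 2, 0),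
    (- 24 * \<alpha> * \<beta>^2, 1, 6, 0, 2), (48 * \<alpha> * \<beta>^2, 1, 4, 4, 0),
    (- 48 * \<alpha> * \<beta>^2, 1, 4, 0, 4), (- 24 * \<alpha> * \<beta>^2, 1, 2, 6, 0),
    (- 72 * \<alpha> * \<beta>^2, 1, 2, 4, 2), (- 72 * \<alpha> * \<beta>^2, 1, 2, 2, 4),
    (- 24 * \<alpha> * \<beta>^2, 1, 2, 0, 6), (24 * \<beta>^3, 8, 0, 1, 0),
    (- 48 * \<beta>^3, 7, 1, 0, 1), (48 * \<beta>^3, 6, 2, 1, 0), (- 8 * \<beta>^3, 6, 0, 3, 0),
    (24 * \<beta>^3, 6, 0, 1, 2), (- 144 * \<beta>^3, 5, 3, 0, 1), (144 * \<beta>^3, 5, 1, 2, 1),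
    (- 48 * \<beta>^3, 5, 1, 0, 3), (120 * \<beta>^3, 4, 2, 3, 0), (- 360 * \<beta>^3, 4, 2, 1, 2),
    (- 144 * \<beta>^3, 3, 5, 0, 1), (- 480 * \<beta>^3, 3, 3, 2, 1), (160 * \<beta>^3, 3, 3, 0, 3),
    (- 48 * \<beta>^3, 2, 6, 1, 0), (- 120 * \<beta>^3, 2, 4, 3, 0), (360 * \<beta>^3, 2, 4, 1, 2),
    (- 48 * \<beta>^3, 1, 7, 0, 1), (144 * \<beta>^3, 1, 5, 2, 1), (- 48 * \<beta>^3, 1, 5, 0, 3),
    (- 24 * \<beta>^3, 0, 8, 1, 0), (8 * \<beta>^3, 0, 6, 3, 0), (- 24 * \<beta>^3, 0, 6, 1, 2)]"

lemma q_comb_eq_polynomial4: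
  assumes "norm u = 1"
  shows "q_comb \<alpha> \<beta> u = polynomial4 (q_terms \<alpha> \<beta>) u"
  unfolding q_comb_eq_comb_form[OF assms]
  by (simp add: comb_form_def inner_4 polynomial4_def q_terms_def monomial4_def power2_eq_square
      power3_eq_cube field_simps)

lemma sphere_integral_q_squared:
  "(LINT u|surface_measure. polynomial4 (q_terms \<alpha> \<beta>) u * polynomial4 (q_terms \<alpha> \<beta>) u) =
    pi\<^sup>2 * (\<alpha>\<^sup>2 / 32 + \<beta>\<^sup>2 / 12)"
  by (subst sphere_integral_polynomial4_mult)
    (simp_all add: q_terms_def sphere_moment_def gauss_moment_values fact_numeral field_simps power2_eq_square)

text \<open>The factor 4 cancels the prefactor 1/4 of the mixed volume.\<close>

lemma sphere_integral_q_det: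
  "(LINT u|surface_measure. polynomial4 (q_terms \<alpha> \<beta>) u * polynomial4 (det_terms \<alpha> \<beta>) u) =
    4 * (pi\<^sup>2 * (- 3 * \<alpha>^4 / 128 + 3 * \<alpha>\<^sup>2 * \<beta>\<^sup>2 / 70 + \<beta>^4 / 7))"
proof -
  have "(\<Sum>(x, e)\<leftarrow>q_terms \<alpha> \<beta>. \<Sum>(y, e')\<leftarrow>det_terms \<alpha> \<beta>. x * y * sphere_moment (e + e')) =
      4 * (- 3 * \<alpha>^4 / 128 + 3 * \<alpha>\<^sup>2 * \<beta>\<^sup>2 / 70 + \<beta>^4 / 7)"
    unfolding q_terms_def det_terms_def
    by (simp add: sphere_moment_def gauss_moment_values fact_numeral, simp add: field_simps, algebra)
  moreover have "\<forall>(x, a, b, c, d)\<in>set (q_terms \<alpha> \<beta>). odd (a + b + c + d)"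
    "\<forall>(x, a, b, c, d)\<in>set (det_terms \<alpha> \<beta>). odd (a + b + c + d)"
    by (simp_all add: q_terms_def det_terms_def)
  ultimately show ?thesis
    by (simp add: sphere_integral_polynomial4_mult)
qed

text \<open>The unit norm enters by replacing \<open>q\<close> with its cubic form. The six entries
  of the symmetric matrix are then explicit cubics, and what remains is an identity of polynomials
  of degree 9.\<close>

lemma det_polynomial4:
  assumes "norm u = 1"
  shows "det (\<chi> i j. 6 * comb_form \<alpha> \<beta> u (quaternion_frame u $ i) (quaternion_frame u $ j)
      - 2 * q_comb \<alpha> \<beta> u * (if i = j then 1 else 0)) = polynomial4 (det_terms \<alpha> \<beta>) u"
proof -
  define m :: "3 \<Rightarrow> 3 \<Rightarrow> real" where
    "m i j = 6 * comb_form \<alpha> \<beta> u (quaternion_frame u $ i) (quaternion_frame u $ j)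
      - 2 * q_comb \<alpha> \<beta> u * (if i = j then 1 else 0)" for i j
  note m = m_def q_comb_eq_comb_form[OF assms] comb_form_def quaternion_frame_nth inner_4 power2_eq_square power3_eq_cube
  have m11: "m 1 1 = - 2 * \<alpha> * u$1^3 + 6 * \<alpha> * u$1 * u$2^2 - 8 * \<beta> * u$1^2 * u$3 + 16 * \<beta> * u$1 * u$2 * u$4 + 8 * \<beta> * u$2^2 * u$3"
    by (simp add: m field_simps)
  have m12: "m 1 2 = 6 * \<alpha> * u$1 * u$2 * u$3 - 2 * \<beta> * u$1^2 * u$2 - 2 * \<beta> * u$2^3 + 4 * \<beta> * u$2 * u$3^2 + 4 * \<beta> * u$2 * u$4^2"
    by (simp add: m field_simps)
  have m13: "m 1 3 = 6 * \<alpha> * u$1 * u$2 * u$4 - 2 * \<beta> * u$1^3 - 2 * \<beta> * u$1 * u$2^2 + 4 * \<beta> * u$1 * u$3^2 + 4 * \<beta> * u$1 * u$4^2"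
    by (simp add: m field_simps)
  have m22: "m 2 2 = - 2 * \<alpha> * u$1^3 + 6 * \<alpha> * u$1 * u$3^2 - 6 * \<beta> * u$1^2 * u$3 + 4 * \<beta> * u$1 * u$2 * u$4 - 2 * \<beta> * u$2^2 * u$3 + 2 * \<beta> * u$3^3 + 2 * \<beta> * u$3 * u$4^2"
    by (simp add: m field_simps)
  have m23: "m 2 3 = 6 * \<alpha> * u$1 * u$3 * u$4 - 4 * \<beta> * u$1^2 * u$4 - 4 * \<beta> * u$2^2 * u$4 + 2 * \<beta> * u$3^2 * u$4 + 2 * \<beta> * u$4^3"
    by (simp add: m field_simps)
  have m33: "m 3 3 = - 2 * \<alpha> * u$1^3 + 6 * \<alpha> * u$1 * u$4^2 + 2 * \<beta> * u$1^2 * u$3 + 4 * \<beta> * u$1 * u$2 * u$4 + 6 * \<beta> * u$2^2 * u$3 - 2 * \<beta> * u$3^3 - 2 * \<beta> * u$3 * u$4^2"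
    by (simp add: m field_simps)
  have sym: "m i j = m j i" for i j
    by (simp add: m_def comb.commute23)
  have "det (\<chi> i j. m i j) = polynomial4 (det_terms \<alpha> \<beta>) u"
    unfolding det_3 vec_lambda_beta sym[of 2 1] sym[of 3 1] sym[of 3 2] m11 m12 m13 m22 m23 m33
    by (simp only: polynomial4_def det_terms_def monomial4_def case_prod_conv list.map sum_list.Cons
        sum_list.Nil power_0 mult_1_right) algebra
  then show ?thesis
    by (simp add: m_def)
qed

section \<open>Energy and quartic volume on the plane\<close>

lemma space_surface_measure: "space surface_measure = sphere 0 1"
  by (simp add: surface_measure_def space_scale_measure space_restrict_space)

lemma energy_eq:
  assumes f: "\<And>u. norm u = 1 \<Longrightarrow> f u = q_comb \<alpha> \<beta> u"
  shows "energy f = pi\<^sup>2 * (\<alpha>\<^sup>2 / 32 + \<beta>\<^sup>2 / 12)"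
proof -
  have "(LINT u|surface_measure. f u * D3 u (Q_op f u) (Q_op (\<lambda>_. 1) u) (Q_op (\<lambda>_. 1) u)) =
      (LINT u|surface_measure. - 4 * (polynomial4 (q_terms \<alpha> \<beta>) u * polynomial4 (q_terms \<alpha> \<beta>) u))"
  proof (rule Bochner_Integration.integral_cong)
    fix u :: "real^4"
    assume "u \<in> space surface_measure"
    then have u: "norm u = 1"
      by (simp add: space_surface_measure)
    have "Q_op (\<lambda>_. 1) u = (\<lambda>v. v)"
      by (simp add: fun_eq_iff Q_op_const)
    with D3_Q_op_Id[OF f u] show "f u * D3 u (Q_op f u) (Q_op (\<lambda>_. 1) u) (Q_op (\<lambda>_. 1) u) =
        - 4 * (polynomial4 (q_terms \<alpha> \<beta>) u * polynomial4 (q_terms \<alpha> \<beta>) u)"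
      using f[OF u] q_comb_eq_polynomial4[OF u] by simp
  qed simp
  also have "\<dots> = - 4 * (pi\<^sup>2 * (\<alpha>\<^sup>2 / 32 + \<beta>\<^sup>2 / 12))"
    by (simp add: sphere_integral_q_squared)
  finally show ?thesis
    by (simp add: energy_def mixed_volume_def)
qed

lemma quartic_volume_eq:
  assumes f: "\<And>u. norm u = 1 \<Longrightarrow> f u = q_comb \<alpha> \<beta> u"
  shows "quartic_volume f = pi\<^sup>2 * (- 3 * \<alpha>^4 / 128 + 3 * \<alpha>\<^sup>2 * \<beta>\<^sup>2 / 70 + \<beta>^4 / 7)"
proof -
  have "(LINT u|surface_measure. f u * D3 u (Q_op f u) (Q_op f u) (Q_op f u)) =
      (LINT u|surface_measure. polynomial4 (q_terms \<alpha> \<beta>) u * polynomial4 (det_terms \<alpha> \<beta>) u)"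
  proof (rule Bochner_Integration.integral_cong)
    fix u :: "real^4"
    assume "u \<in> space surface_measure"
    then have u: "norm u = 1"
      by (simp add: space_surface_measure)
    show "f u * D3 u (Q_op f u) (Q_op f u) (Q_op f u) =
        polynomial4 (q_terms \<alpha> \<beta>) u * polynomial4 (det_terms \<alpha> \<beta>) u"
      using tangent_det_Q_op[OF f u, of 0] det_polynomial4[OF u, of \<alpha> \<beta>] f[OF u] q_comb_eq_polynomial4[OF u]
      by (simp add: D3_diag)
  qed simp
  then show ?thesis
    by (simp add: quartic_volume_def mixed_volume_def sphere_integral_q_det)
qed

text \<open>A function vanishing on the sphere agrees there with \<open>q_comb 0 0\<close> and so
  has energy 0, while the energy is positive definite in the two parameters.\<close>

lemma q_comb_eq_0_iff: "(\<forall>u\<in>sphere 0 1. q_comb \<alpha> \<beta> u = 0) \<longleftrightarrow> \<alpha> = 0 \<and> \<beta> = 0"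
proof
  assume q: "\<forall>u\<in>sphere 0 1. q_comb \<alpha> \<beta> u = 0"
  then have "energy (q_comb \<alpha> \<beta>) = pi\<^sup>2 * (0\<^sup>2 / 32 + 0\<^sup>2 / 12)"
    by (intro energy_eq) (simp add: q_comb_def)
  then have "\<alpha>\<^sup>2 / 32 + \<beta>\<^sup>2 / 12 = 0"
    using energy_eq[of "q_comb \<alpha> \<beta>" \<alpha> \<beta>] by simp
  then show "\<alpha> = 0 \<and> \<beta> = 0"
    by (simp add: add_nonneg_eq_0_iff)
qed (simp add: q_comb_def)

text \<open>The constant 24 is the one for which the \<open>\<alpha>^4\<close> terms cancel; the
  rest is \<open>\<beta>^2\<close> times a positive definite form, which yields the inequality and
  its equality case together.\<close>

lemma quartic_volume_lower_gap:
  "quartic_volume (q_comb \<alpha> \<beta>) + 24 / pi\<^sup>2 * (energy (q_comb \<alpha> \<beta>))\<^sup>2 =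
    pi\<^sup>2 * \<beta>\<^sup>2 * (47 / 280 * \<alpha>\<^sup>2 + 13 / 42 * \<beta>\<^sup>2)"
  by (simp add: energy_eq quartic_volume_eq field_simps power2_eq_square power4_eq_xxxx)

text \<open>Here 144/7 cancels the \<open>\<beta>^4\<close> terms instead.\<close>

lemma quartic_volume_upper_gap:
  "144 / (7 * pi\<^sup>2) * (energy (q_comb \<alpha> \<beta>))\<^sup>2 - quartic_volume (q_comb \<alpha> \<beta>) =
    pi\<^sup>2 * \<alpha>\<^sup>2 * (39 / 896 * \<alpha>\<^sup>2 + 9 / 140 * \<beta>\<^sup>2)"
  by (simp add: energy_eq quartic_volume_eq field_simps power2_eq_square power4_eq_xxxx)

lemma vanishing_ratio_pos: "0 < (sqrt 1194 - 12) / 80"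
proof -
  have "12 < sqrt 1194"
    by (rule real_less_rsqrt) simp
  then show ?thesis
    by simp
qed

lemma quartic_volume_eq_0_iff:
  assumes "(\<alpha>, \<beta>) \<noteq> (0, 0)"
  shows "quartic_volume (q_comb \<alpha> \<beta>) = 0 \<longleftrightarrow> \<alpha> \<noteq> 0 \<and> \<beta>\<^sup>2 / \<alpha>\<^sup>2 = (sqrt 1194 - 12) / 80"
proof (cases "\<alpha> = 0")
  case True
  with assms show ?thesis
    by (simp add: quartic_volume_eq)
next
  case False
  define t where "t = \<beta>\<^sup>2 / \<alpha>\<^sup>2"
  have "t \<ge> 0" and \<beta>: "\<beta>\<^sup>2 = t * \<alpha>\<^sup>2"
    using False by (simp_all add: t_def)
  let ?s = "sqrt 1194"
  have "quartic_volume (q_comb \<alpha> \<beta>) = pi\<^sup>2 * (- 3 / 128 * (\<alpha>\<^sup>2)\<^sup>2 + 3 / 70 * \<alpha>\<^sup>2 * \<beta>\<^sup>2 + (\<beta>\<^sup>2)\<^sup>2 / 7)"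
    by (simp add: quartic_volume_eq)
  \<comment> \<open>Completing the square in \<open>t^2 + 3/10 t - 21/128\<close>; the second root
    is negative and is excluded by \<open>t \<ge> 0\<close>.\<close>
  also have "\<dots> = pi\<^sup>2 * (\<alpha>\<^sup>2)\<^sup>2 / 7 * ((t + 12 / 80)\<^sup>2 - ?s\<^sup>2 / 80\<^sup>2)"
    unfolding \<beta> by (simp add: field_simps power2_eq_square)
  also have "(t + 12 / 80)\<^sup>2 - ?s\<^sup>2 / 80\<^sup>2 = (t - (?s - 12) / 80) * (t + (?s + 12) / 80)"
    by (simp add: field_simps power2_eq_square)
  finally have "quartic_volume (q_comb \<alpha> \<beta>) =
      pi\<^sup>2 * (\<alpha>\<^sup>2)\<^sup>2 / 7 * ((t - (?s - 12) / 80) * (t + (?s + 12) / 80))" .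
  moreover have "pi\<^sup>2 * (\<alpha>\<^sup>2)\<^sup>2 / 7 \<noteq> 0"
    using False by simp
  ultimately have "quartic_volume (q_comb \<alpha> \<beta>) = 0 \<longleftrightarrow> t = (?s - 12) / 80 \<or> t + (?s + 12) / 80 = 0"
    by (simp only: mult_eq_0_iff simp_thms right_minus_eq)
  moreover have "t + (?s + 12) / 80 > 0"
    using \<open>t \<ge> 0\<close> by (intro add_nonneg_pos divide_pos_pos add_nonneg_pos) auto
  ultimately show ?thesis
    using False by (auto simp: t_def)
qed

lemma quartic_volume_bounds:
  "\<forall>\<alpha> \<beta>. (\<exists>u\<in>sphere 0 1. q_comb \<alpha> \<beta> u \<noteq> 0) \<longrightarrow>
        - 24 / pi^2 * (energy (q_comb \<alpha> \<beta>))^2 \<le> quartic_volume (q_comb \<alpha> \<beta>) \<and>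
        quartic_volume (q_comb \<alpha> \<beta>) \<le> 144 / (7 * pi^2) * (energy (q_comb \<alpha> \<beta>))^2 \<and>
        (quartic_volume (q_comb \<alpha> \<beta>) = - 24 / pi^2 * (energy (q_comb \<alpha> \<beta>))^2 \<longleftrightarrow> \<beta> = 0) \<and>
        (quartic_volume (q_comb \<alpha> \<beta>) = 144 / (7 * pi^2) * (energy (q_comb \<alpha> \<beta>))^2 \<longleftrightarrow> \<alpha> = 0)"
proof (intro allI impI)
  fix \<alpha> \<beta> :: real
  assume "\<exists>u\<in>sphere 0 1. q_comb \<alpha> \<beta> u \<noteq> 0"
  then have nz: "\<alpha> \<noteq> 0 \<or> \<beta> \<noteq> 0"
    using q_comb_eq_0_iff[of \<alpha> \<beta>] by blast
  define l where "l = pi\<^sup>2 * \<beta>\<^sup>2 * (47 / 280 * \<alpha>\<^sup>2 + 13 / 42 * \<beta>\<^sup>2)"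
  define r where "r = pi\<^sup>2 * \<alpha>\<^sup>2 * (39 / 896 * \<alpha>\<^sup>2 + 9 / 140 * \<beta>\<^sup>2)"
  have "l \<ge> 0" "r \<ge> 0"
    by (simp_all add: l_def r_def)
  moreover have "47 / 280 * \<alpha>\<^sup>2 + 13 / 42 * \<beta>\<^sup>2 \<noteq> 0" "39 / 896 * \<alpha>\<^sup>2 + 9 / 140 * \<beta>\<^sup>2 \<noteq> 0"
    using nz by (auto simp: add_nonneg_eq_0_iff)
  then have "l = 0 \<longleftrightarrow> \<beta> = 0" "r = 0 \<longleftrightarrow> \<alpha> = 0"
    by (auto simp: l_def r_def)
  ultimately show "- 24 / pi^2 * (energy (q_comb \<alpha> \<beta>))^2 \<le> quartic_volume (q_comb \<alpha> \<beta>) \<and>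
        quartic_volume (q_comb \<alpha> \<beta>) \<le> 144 / (7 * pi^2) * (energy (q_comb \<alpha> \<beta>))^2 \<and>
        (quartic_volume (q_comb \<alpha> \<beta>) = - 24 / pi^2 * (energy (q_comb \<alpha> \<beta>))^2 \<longleftrightarrow> \<beta> = 0) \<and>
        (quartic_volume (q_comb \<alpha> \<beta>) = 144 / (7 * pi^2) * (energy (q_comb \<alpha> \<beta>))^2 \<longleftrightarrow> \<alpha> = 0)"
    using quartic_volume_lower_gap[of \<alpha> \<beta>, folded l_def] quartic_volume_upper_gap[of \<alpha> \<beta>, folded r_def] by auto
qed

lemma quartic_volume_bounds_optimal:
  "(\<forall>c. (\<forall>\<alpha> \<beta>. (\<exists>u\<in>sphere 0 1. q_comb \<alpha> \<beta> u \<noteq> 0) \<longrightarrow>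
              c * (energy (q_comb \<alpha> \<beta>))^2 \<le> quartic_volume (q_comb \<alpha> \<beta>))
          \<longrightarrow> c \<le> - 24 / pi^2) \<and>
     (\<forall>c. (\<forall>\<alpha> \<beta>. (\<exists>u\<in>sphere 0 1. q_comb \<alpha> \<beta> u \<noteq> 0) \<longrightarrow>
              quartic_volume (q_comb \<alpha> \<beta>) \<le> c * (energy (q_comb \<alpha> \<beta>))^2)
          \<longrightarrow> 144 / (7 * pi^2) \<le> c)"
proof (intro conjI allI impI)
  have nz: "\<exists>u\<in>sphere 0 1. q_comb 1 0 u \<noteq> 0" "\<exists>u\<in>sphere 0 1. q_comb 0 1 u \<noteq> 0"
    using q_comb_eq_0_iff[of 1 0] q_comb_eq_0_iff[of 0 1] by auto
  have E: "(energy (q_comb 1 0))\<^sup>2 > 0" "(energy (q_comb 0 1))\<^sup>2 > 0"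
    by (simp_all add: energy_eq)
  fix c :: real
  {
    assume "\<forall>\<alpha> \<beta>. (\<exists>u\<in>sphere 0 1. q_comb \<alpha> \<beta> u \<noteq> 0) \<longrightarrow>
              c * (energy (q_comb \<alpha> \<beta>))^2 \<le> quartic_volume (q_comb \<alpha> \<beta>)"
    then have "c * (energy (q_comb 1 0))^2 \<le> quartic_volume (q_comb 1 0)"
      using nz by blast
    also have "\<dots> = - 24 / pi^2 * (energy (q_comb 1 0))^2"
      using quartic_volume_lower_gap[of 1 0] by simp
    finally show "c \<le> - 24 / pi^2"
      using E by (simp only: mult_le_cancel_right_pos)
  next
    assume "\<forall>\<alpha> \<beta>. (\<exists>u\<in>sphere 0 1. q_comb \<alpha> \<beta> u \<noteq> 0) \<longrightarrow>
              quartic_volume (q_comb \<alpha> \<beta>) \<le> c * (energy (q_comb \<alpha> \<beta>))^2"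
    then have "quartic_volume (q_comb 0 1) \<le> c * (energy (q_comb 0 1))^2"
      using nz by blast
    moreover have "quartic_volume (q_comb 0 1) = 144 / (7 * pi^2) * (energy (q_comb 0 1))^2"
      using quartic_volume_upper_gap[of 0 1] by simp
    ultimately show "144 / (7 * pi^2) \<le> c"
      using E by (simp only: mult_le_cancel_right_pos)
  }
qed

section \<open>Smooth maps\<close>

text \<open>Openness is what makes derivatives at points of \<open>S\<close> depend only on the
  values on \<open>S\<close>; this allows the total operator \<open>frechet_derivative\<close> to be
  replaced by explicit formulas.\<close>

lemma Ck_on_cong:
  assumes "open S" "\<And>x. x \<in> S \<Longrightarrow> f x = g x"
  shows "Ck_on k f S \<longleftrightarrow> Ck_on k g S"
  using assms(2)
proof (induction k arbitrary: f g)
  case 0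
  then show ?case
    by (simp cong: continuous_on_cong)
next
  case (Suc k)
  have D: "(f has_derivative f') (at x) \<longleftrightarrow> (g has_derivative f') (at x)" if "x \<in> S" for x f'
    using has_derivative_transform_within_open[OF _ assms(1) that] Suc.prems by metis
  then have "f differentiable (at x) \<longleftrightarrow> g differentiable (at x)" if "x \<in> S" for x
    using that by (simp add: differentiable_def)
  moreover have "frechet_derivative f (at x) = frechet_derivative g (at x)" if "x \<in> S" for x
    using D[OF that] by (simp add: frechet_derivative_def)
  ultimately show ?case
    using Suc.IH[of "\<lambda>x. frechet_derivative f (at x) v" "\<lambda>x. frechet_derivative g (at x) v" for v] by simp
qed

lemma Ck_on_SucI:
  assumes "open S" "\<And>x. x \<in> S \<Longrightarrow> (f has_derivative f' x) (at x)" "\<And>v. Ck_on k (\<lambda>x. f' x v) S"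
  shows "Ck_on (Suc k) f S"
proof -
  have "frechet_derivative f (at x) = f' x" if "x \<in> S" for x
    using assms(2)[OF that] by (rule frechet_derivative_at[symmetric])
  then have "Ck_on k (\<lambda>x. frechet_derivative f (at x) v) S" for v
    using assms(3)[of v] Ck_on_cong[OF assms(1), of "\<lambda>x. frechet_derivative f (at x) v" "\<lambda>x. f' x v" k] by simp
  then show ?thesis
    using assms(2) by (auto simp: differentiable_def)
qed

lemma Ck_on_SucD:
  assumes "Ck_on (Suc k) f S"
  shows "x \<in> S \<Longrightarrow> (f has_derivative frechet_derivative f (at x)) (at x)"
    and "Ck_on k (\<lambda>x. frechet_derivative f (at x) v) S"
  using assms by (simp_all add: frechet_derivative_works)

lemma Ck_on_imp_continuous_on: "Ck_on k f S \<Longrightarrow> continuous_on S f"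
  by (cases k) (auto intro!: continuous_at_imp_continuous_on differentiable_imp_continuous_within)

text \<open>In the inductions for products, inverses and roots, the derivative contains the
  functions themselves, which are then required at the lower order.\<close>

lemma Ck_on_Suc_imp: "Ck_on (Suc k) f S \<Longrightarrow> Ck_on k f S"
proof (induction k arbitrary: f)
  case 0
  then show ?case
    using Ck_on_imp_continuous_on[of "Suc 0" f S] by simp
next
  case (Suc k)
  then show ?case
    by simp
qed

lemma Ck_on_const: "Ck_on k (\<lambda>_. c) S"
proof (induction k arbitrary: c)
  case (Suc k)
  then show ?case
    by simp
qed (simp add: continuous_on_const)

lemma Ck_on_bounded_linear:
  assumes "bounded_linear f" "open S"
  shows "Ck_on k f S"
proof (cases k)
  case 0
  then show ?thesis
    using assms(1) by (simp add: linear_continuous_on)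
next
  case (Suc j)
  show ?thesis
    unfolding Suc using assms
    by (intro Ck_on_SucI[where f' = "\<lambda>_. f"]) (auto intro: bounded_linear_imp_has_derivative Ck_on_const)
qed

lemma Ck_on_add:
  assumes "open S"
  shows "Ck_on k f S \<Longrightarrow> Ck_on k g S \<Longrightarrow> Ck_on k (\<lambda>x. f x + g x) S"
proof (induction k arbitrary: f g)
  case (Suc k)
  show ?case
  proof (rule Ck_on_SucI[OF assms])
    show "((\<lambda>x. f x + g x) has_derivative
        (\<lambda>v. frechet_derivative f (at x) v + frechet_derivative g (at x) v)) (at x)" if "x \<in> S" for x
      using that by (intro has_derivative_add Suc.prems[THEN Ck_on_SucD(1)])
    show "Ck_on k (\<lambda>x. frechet_derivative f (at x) v + frechet_derivative g (at x) v) S" for v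
      by (intro Suc.IH Suc.prems[THEN Ck_on_SucD(2)])
  qed
qed (simp add: continuous_on_add)

lemma Ck_on_inner_const:
  assumes "open S"
  shows "Ck_on k f S \<Longrightarrow> Ck_on k (\<lambda>x. f x \<bullet> b) S"
proof (induction k arbitrary: f)
  case (Suc k)
  show ?case
  proof (rule Ck_on_SucI[OF assms])
    show "((\<lambda>x. f x \<bullet> b) has_derivative (\<lambda>v. frechet_derivative f (at x) v \<bullet> b)) (at x)" if "x \<in> S" for x
      using that by (intro has_derivative_inner_left Suc.prems[THEN Ck_on_SucD(1)])
    show "Ck_on k (\<lambda>x. frechet_derivative f (at x) v \<bullet> b) S" for v
      by (intro Suc.IH Suc.prems[THEN Ck_on_SucD(2)])
  qed
qed (simp add: continuous_on_inner continuous_on_const)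

lemma Ck_on_scaleR:
  fixes f :: "'a::euclidean_space \<Rightarrow> real" and g :: "'a \<Rightarrow> 'b::euclidean_space"
  assumes "open S"
  shows "Ck_on k f S \<Longrightarrow> Ck_on k g S \<Longrightarrow> Ck_on k (\<lambda>x. f x *\<^sub>R g x) S"
proof (induction k arbitrary: f g)
  case (Suc k)
  show ?case
  proof (rule Ck_on_SucI[OF assms])
    show "((\<lambda>x. f x *\<^sub>R g x) has_derivative
        (\<lambda>v. f x *\<^sub>R frechet_derivative g (at x) v + frechet_derivative f (at x) v *\<^sub>R g x)) (at x)"
      if "x \<in> S" for x
      using that by (intro has_derivative_scaleR Suc.prems[THEN Ck_on_SucD(1)])
    show "Ck_on k (\<lambda>x. f x *\<^sub>R frechet_derivative g (at x) v + frechet_derivative f (at x) v *\<^sub>R g x) S" for v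
      by (intro Ck_on_add assms Suc.IH Suc.prems[THEN Ck_on_SucD(2)] Suc.prems[THEN Ck_on_Suc_imp])
  qed
qed (simp add: continuous_on_scaleR)

lemma Ck_on_mult:
  fixes f g :: "'a::euclidean_space \<Rightarrow> real"
  assumes "open S" "Ck_on k f S" "Ck_on k g S"
  shows "Ck_on k (\<lambda>x. f x * g x) S"
  using Ck_on_scaleR[OF assms] by simp

lemma Ck_on_inverse:
  fixes f :: "'a::euclidean_space \<Rightarrow> real"
  assumes "open S" and f: "\<And>x. x \<in> S \<Longrightarrow> f x \<noteq> 0"
  shows "Ck_on k f S \<Longrightarrow> Ck_on k (\<lambda>x. inverse (f x)) S"
proof (induction k)
  case 0
  then show ?case
    using f by (simp add: continuous_on_inverse)
next
  case (Suc k)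
  show ?case
  proof (rule Ck_on_SucI[OF assms(1)])
    show "((\<lambda>x. inverse (f x)) has_derivative
        (\<lambda>v. - (inverse (f x) * frechet_derivative f (at x) v * inverse (f x)))) (at x)" if "x \<in> S" for x
      using that by (intro Deriv.has_derivative_inverse f Suc.prems[THEN Ck_on_SucD(1)])
    have "Ck_on k (\<lambda>x. inverse (f x) * frechet_derivative f (at x) v * inverse (f x)) S" for v
      by (intro Ck_on_mult assms(1) Suc.IH Suc.prems[THEN Ck_on_SucD(2)] Suc.prems[THEN Ck_on_Suc_imp])
    from Ck_on_mult[OF assms(1) Ck_on_const[of k "-1"] this]
    show "Ck_on k (\<lambda>x. - (inverse (f x) * frechet_derivative f (at x) v * inverse (f x))) S" for v
      by simp
  qed
qed

lemma Ck_on_sqrt: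
  fixes f :: "'a::euclidean_space \<Rightarrow> real"
  assumes "open S" and f: "\<And>x. x \<in> S \<Longrightarrow> f x > 0"
  shows "Ck_on k f S \<Longrightarrow> Ck_on k (\<lambda>x. sqrt (f x)) S"
proof (induction k)
  case 0
  then show ?case
    by (simp add: continuous_on_real_sqrt)
next
  case (Suc k)
  show ?case
  proof (rule Ck_on_SucI[OF assms(1)])
    show "((\<lambda>x. sqrt (f x)) has_derivative
        (\<lambda>v. frechet_derivative f (at x) v * (inverse (sqrt (f x)) * (1/2)))) (at x)" if "x \<in> S" for x
      by (rule has_derivative_eq_rhs[OF has_derivative_real_sqrt[OF f[OF that] Ck_on_SucD(1)[OF Suc.prems that]]])
        (simp add: fun_eq_iff field_simps)
    have "sqrt (f x) \<noteq> 0" if "x \<in> S" for x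
      using f[OF that] by simp
    then show "Ck_on k (\<lambda>x. frechet_derivative f (at x) v * (inverse (sqrt (f x)) * (1/2))) S" for v
      by (intro Ck_on_mult Ck_on_inverse assms(1) Suc.IH Ck_on_const Suc.prems[THEN Ck_on_SucD(2)]
          Suc.prems[THEN Ck_on_Suc_imp])
  qed
qed

lemma smooth_on_sum:
  assumes "open S" "\<And>i. i \<in> I \<Longrightarrow> smooth_on (f i) S"
  shows "smooth_on (\<lambda>x. \<Sum>i\<in>I. f i x) S"
  using assms(2)
  by (induction I rule: infinite_finite_induct) (auto simp: smooth_on_def intro!: Ck_on_const Ck_on_add[OF assms(1)])

lemma smooth_on_euclidean:
  assumes "open S" "\<And>b. b \<in> Basis \<Longrightarrow> smooth_on (\<lambda>x. f x \<bullet> b) S"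
  shows "smooth_on f S"
proof -
  have "smooth_on (\<lambda>x. \<Sum>b\<in>Basis. (f x \<bullet> b) *\<^sub>R b) S"
    using assms by (intro smooth_on_sum) (auto simp: smooth_on_def intro!: Ck_on_scaleR Ck_on_const)
  then show ?thesis
    by (simp add: euclidean_representation)
qed

lemma smooth_on_cong:
  "open S \<Longrightarrow> (\<And>x. x \<in> S \<Longrightarrow> f x = g x) \<Longrightarrow> smooth_on f S \<longleftrightarrow> smooth_on g S"
  by (simp add: smooth_on_def Ck_on_cong[of S f g])

lemma smooth_on_intros:
  assumes "open S"
  shows "smooth_on (\<lambda>_. c) S"
    and "smooth_on f S \<Longrightarrow> smooth_on g S \<Longrightarrow> smooth_on (\<lambda>x. f x + g x) S"
    and "smooth_on a S \<Longrightarrow> smooth_on g S \<Longrightarrow> smooth_on (\<lambda>x. a x *\<^sub>R g x) S"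
    and "smooth_on a S \<Longrightarrow> smooth_on b S \<Longrightarrow> smooth_on (\<lambda>x. a x * b x) S"
    and "smooth_on a S \<Longrightarrow> (\<And>x. x \<in> S \<Longrightarrow> a x \<noteq> 0) \<Longrightarrow> smooth_on (\<lambda>x. inverse (a x)) S"
    and "smooth_on a S \<Longrightarrow> (\<And>x. x \<in> S \<Longrightarrow> a x > 0) \<Longrightarrow> smooth_on (\<lambda>x. sqrt (a x)) S"
  using assms by (auto simp: smooth_on_def intro: Ck_on_const Ck_on_add Ck_on_scaleR
      Ck_on_mult Ck_on_inverse Ck_on_sqrt)

lemma smooth_on_bounded_linear:
  "open S \<Longrightarrow> bounded_linear l \<Longrightarrow> smooth_on l S"
  by (simp add: smooth_on_def Ck_on_bounded_linear)

lemma smooth_on_inner_const: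
  "open S \<Longrightarrow> smooth_on f S \<Longrightarrow> smooth_on (\<lambda>x. f x \<bullet> b) S"
  by (simp add: smooth_on_def Ck_on_inner_const)

lemma smooth_on_norm: "smooth_on norm (- {0 :: 'a::euclidean_space})"
proof -
  have o: "open (- {0 :: 'a})"
    by (simp add: open_Compl)
  have "smooth_on (\<lambda>x::'a. x \<bullet> x) (- {0})"
    unfolding euclidean_inner[of x x for x :: 'a]
    by (intro smooth_on_sum smooth_on_intros(4) smooth_on_bounded_linear o bounded_linear_inner_left)
  then have "smooth_on (\<lambda>x::'a. sqrt (x \<bullet> x)) (- {0})"
    by (intro smooth_on_intros o) auto
  then show ?thesis
    unfolding norm_eq_sqrt_inner .
qed

context cubic_form
begin

lemma smooth_on_form:
  assumes "open S" "smooth_on f S" "smooth_on g S" "smooth_on h S"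
  shows "smooth_on (\<lambda>x. T (f x) (g x) (h x)) S"
proof -
  have "T (f x) (g x) (h x) = (\<Sum>b\<in>Basis. (f x \<bullet> b) * (\<Sum>c\<in>Basis. (g x \<bullet> c) * (\<Sum>d\<in>Basis. (h x \<bullet> d) * T d c b)))" for x
    by (subst basis_expansion, subst commute12, subst basis_expansion, subst rotate, subst basis_expansion) simp
  then show ?thesis
    by (simp only:) (intro smooth_on_sum smooth_on_intros smooth_on_inner_const assms)
qed

end

section \<open>Convex bodies with support function \<open>r + t q\<close>\<close>

text \<open>Along a kernel direction of the derivative the increment of \<open>f\<close> is of
  smaller order than the step, contradicting linear expansion.\<close>

lemma inj_derivative_if_expanding:
  fixes f :: "'a::euclidean_space \<Rightarrow> 'b::euclidean_space"
  assumes f: "(f has_derivative f') (at x)" and U: "open U" "x \<in> U" and "c > 0"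
    and expanding: "\<And>y. y \<in> U \<Longrightarrow> c * norm (y - x) \<le> norm (f y - f x)"
  shows "inj f'"
proof -
  interpret bounded_linear f'
    using f by (rule has_derivative_bounded_linear)
  have "v = 0" if v: "f' v = 0" for v
  proof (rule ccontr)
    assume "v \<noteq> 0"
    obtain d where d: "d > 0" "\<And>y. norm (y - x) < d \<Longrightarrow> norm (f y - f x - f' (y - x)) \<le> c / 2 * norm (y - x)"
      using f[unfolded has_derivative_at_alt] \<open>c > 0\<close> by (meson half_gt_zero)
    obtain d' where d': "d' > 0" "ball x d' \<subseteq> U"
      using U open_contains_ball by blast
    \<comment> \<open>The step has length \<open>min d d' / 2\<close>, inside both the region of the
      derivative estimate and \<open>U\<close>.\<close>
    define s where "s = min d d' / (2 * norm v)"
    have s: "s > 0" "norm (s *\<^sub>R v) < d" "norm (s *\<^sub>R v) < d'"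
      using d(1) d'(1) \<open>v \<noteq> 0\<close> by (auto simp: s_def)
    have "x + s *\<^sub>R v \<in> U"
      using d'(2) s(3) by (auto simp: dist_norm subset_iff)
    then have "c * norm (s *\<^sub>R v) \<le> norm (f (x + s *\<^sub>R v) - f x)"
      using expanding[of "x + s *\<^sub>R v"] by simp
    also have "\<dots> \<le> c / 2 * norm (s *\<^sub>R v)"
      using d(2)[of "x + s *\<^sub>R v"] s(2) v by (simp add: scaleR)
    finally show False
      using \<open>c > 0\<close> \<open>s > 0\<close> \<open>v \<noteq> 0\<close> by simp
  qed
  then show ?thesis
    by (simp add: linear_injective_0[OF linear_axioms])
qed

text \<open>Expansion makes \<open>f\<close> injective and its inverse Lipschitz with constant
  \<open>1 / c\<close>.\<close>

lemma homeomorphism_if_expanding: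
  fixes f :: "'a::metric_space \<Rightarrow> 'b::metric_space"
  assumes "continuous_on U f" "c > 0" and expanding: "\<And>x y. x \<in> U \<Longrightarrow> y \<in> U \<Longrightarrow> c * dist x y \<le> dist (f x) (f y)"
  shows "homeomorphism U (f ` U) f (inv_into U f)"
proof -
  have inj: "inj_on f U"
    using expanding \<open>c > 0\<close> by (fastforce simp: inj_on_def mult_le_0_iff)
  have "(1 / c)-lipschitz_on (f ` U) (inv_into U f)"
    using expanding \<open>c > 0\<close> inj by (intro lipschitz_onI) (auto simp: field_simps)
  then have "continuous_on (f ` U) (inv_into U f)"
    by (rule lipschitz_on_continuous_on)
  with inj assms(1) show ?thesis
    by (simp add: homeomorphism_def f_inv_into_f inv_into_image_cancel)
qed

text \<open>A proper convex combination of two points that are not both \<open>p\<close> satisfies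
  the strict inequality. Used to show that a convex hull meets a supporting hyperplane in one point
  only.\<close>

lemma convex_insert_open_halfspace:
  fixes p u :: "'a::real_inner"
  assumes "p \<bullet> u = b"
  shows "convex (insert p {y. y \<bullet> u < b})"
proof (rule convexI)
  fix x y :: 'a and s s' :: real
  assume x: "x \<in> insert p {y. y \<bullet> u < b}" and y: "y \<in> insert p {y. y \<bullet> u < b}"
    and s: "0 \<le> s" "0 \<le> s'" "s + s' = 1"
  consider "x = p" "y = p" | "s = 0" | "s' = 0" | "s > 0" "s' > 0" "x \<bullet> u < b \<or> y \<bullet> u < b"
    using x y s by force
  then show "s *\<^sub>R x + s' *\<^sub>R y \<in> insert p {y. y \<bullet> u < b}"
  proof cases
    case 1
    then show ?thesis
      using s by (simp flip: scaleR_left_distrib)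
  next
    case 4
    have "x \<bullet> u \<le> b" "y \<bullet> u \<le> b"
      using x y assms by auto
    with 4 have "s * (x \<bullet> u) + s' * (y \<bullet> u) < s * b + s' * b"
      by (metis add_le_less_mono add_less_le_mono mult_left_mono mult_strict_left_mono less_imp_le)
    also have "\<dots> = b"
      using s by (simp flip: distrib_right)
    finally show ?thesis
      by (simp add: inner_add_left)
  qed (use x y s in auto)
qed

section \<open>Candidate boundary points and the quadratic gap\<close>

context cubic_form
begin

text \<open>The gradient of the \<open>1\<close>-homogeneous extension of \<open>u \<mapsto> r + t T u u u\<close>, i.e. the point of the body with
  outer normal \<open>u\<close>.\<close>

definition boundary_point :: "real \<Rightarrow> real \<Rightarrow> 'a \<Rightarrow> 'a" where
  "boundary_point r t u = r *\<^sub>R u + t *\<^sub>R (3 *\<^sub>R sharp u u - (2 * T u u u) *\<^sub>R u)"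

lemma inner_boundary_point: "norm u = 1 \<Longrightarrow> boundary_point r t u \<bullet> u = r + t * T u u u"
  by (simp add: boundary_point_def inner_add_left inner_diff_left inner_sharp norm_eq_1)

text \<open>Taylor expansion of the cubic at \<open>v\<close>; the first-order terms cancel because \<open>u \<bullet> v = 1 - |u - v|\<^sup>2 / 2\<close>.\<close>

lemma support_gap:
  assumes u: "norm u = 1" and v: "norm v = 1" and w: "w = u - v"
  shows "r + t * T u u u - boundary_point r t v \<bullet> u =
    r / 2 * (norm w)\<^sup>2 + t * (3 * T v w w + T w w w - T v v v * (norm w)\<^sup>2)"
proof -
  have "(norm w)\<^sup>2 = 2 - 2 * (v \<bullet> u)"
    unfolding w power2_norm_eq_inner using u v by (simp add: inner_diff_left inner_diff_right norm_eq_1 inner_commute)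
  then have vu: "v \<bullet> u = 1 - (norm w)\<^sup>2 / 2"
    by linarith
  have "u = v + w"
    by (simp add: w)
  have "T u u u = T v v v + 3 * T v v w + 3 * T v w w + T w w w"
    unfolding \<open>u = v + w\<close> using commute12[of w v v] commute23[of v w v] commute12[of w v w] commute23[of w w v]
    by (simp add: add)
  moreover have "T v v u = T v v v + T v v w"
    unfolding \<open>u = v + w\<close> by (simp add: add)
  ultimately show ?thesis
    by (simp add: boundary_point_def inner_add_left inner_diff_left inner_sharp vu algebra_simps)
qed

lemma continuous_on_boundary_point: "continuous_on S (boundary_point r t)"
proof -
  have "continuous_on S (\<lambda>u. T u u u)"
    using has_derivative_diag[OF has_derivative_ident]
    by (auto intro: continuous_at_imp_continuous_on has_derivative_continuous)
  then show ?thesis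
    unfolding boundary_point_def
    by (intro continuous_intros bounded_bilinear.continuous_on[OF bounded_bilinear_sharp])
qed

lemma norm_boundary_point_diff:
  assumes B: "\<And>x y z. \<bar>T x y z\<bar> \<le> B * norm x * norm y * norm z" and u: "norm u = 1"
  shows "norm (boundary_point r t u - r *\<^sub>R u) \<le> 5 * B * \<bar>t\<bar>"
proof -
  \<comment> \<open>Testing the form on its own Riesz representative bounds that representative by
    \<open>B\<close>; then \<open>3 B + 2 B\<close> gives the factor 5.\<close>
  have "norm (sharp u u) * norm (sharp u u) = T u u (sharp u u)"
    by (simp add: inner_sharp[symmetric] power2_norm_eq_inner[symmetric] power2_eq_square)
  also have "\<dots> \<le> B * norm (sharp u u)"
    using B[of u u "sharp u u"] u by simp
  finally have "norm (sharp u u) \<le> B"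
    using B[of u u u] u by (cases "sharp u u = 0") auto
  moreover have "\<bar>T u u u\<bar> \<le> B"
    using B[of u u u] u by simp
  moreover have "norm (3 *\<^sub>R sharp u u - (2 * T u u u) *\<^sub>R u) \<le> 3 * norm (sharp u u) + 2 * \<bar>T u u u\<bar>"
    using norm_triangle_ineq4[of "3 *\<^sub>R sharp u u" "(2 * T u u u) *\<^sub>R u"] u by (simp add: abs_mult)
  ultimately have "norm (3 *\<^sub>R sharp u u - (2 * T u u u) *\<^sub>R u) \<le> 5 * B"
    by linarith
  then show ?thesis
    by (simp add: boundary_point_def mult_left_mono mult.commute[of _ "\<bar>t\<bar>"])
qed

end

text \<open>Geometrically, \<open>gap\<close> puts every candidate \<open>N v\<close> below the
  supporting hyperplane through \<open>N u\<close> with normal \<open>u\<close>, by a margin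
  quadratic in the distance of the normals: a quantitative form of strict convexity.\<close>

locale cubic_body = cubic_form T for T :: "'a::euclidean_space \<Rightarrow> 'a \<Rightarrow> 'a \<Rightarrow> real" +
  fixes r t c :: real
  assumes r_pos: "r > 0" and c_pos: "c > 0"
    and gap: "norm u = 1 \<Longrightarrow> norm v = 1 \<Longrightarrow>
      c * (norm (u - v))\<^sup>2 \<le> r + t * T u u u - boundary_point r t v \<bullet> u"
begin

abbreviation N :: "'a \<Rightarrow> 'a" where
  "N \<equiv> boundary_point r t"

definition body :: "'a set" where
  "body = convex hull (N ` sphere 0 1)"

lemma compact_body: "compact body" and convex_body: "convex body"
  unfolding body_def
  by (intro compact_convex_hull compact_continuous_image continuous_on_boundary_point) auto

lemma N_in_body: "norm u = 1 \<Longrightarrow> N u \<in> body"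
  unfolding body_def by (rule hull_inc) auto

text \<open>Each \<open>N u\<close> is the only point of the body on its supporting hyperplane: the
  gap shows this for the generating points, and convexity of the right-hand side extends it to their
  hull.\<close>

lemma body_subset_exposed:
  assumes u: "norm u = 1"
  shows "body \<subseteq> insert (N u) {y. y \<bullet> u < r + t * T u u u}"
  unfolding body_def
proof (rule hull_minimal)
  show "N ` sphere 0 1 \<subseteq> insert (N u) {y. y \<bullet> u < r + t * T u u u}"
  proof clarsimp
    fix v assume v: "norm v = 1" and "N v \<noteq> N u"
    then have "u \<noteq> v"
      by auto
    then have "0 < c * (norm (u - v))\<^sup>2"
      using c_pos by simp
    with gap[OF u v] show "N v \<bullet> u < r + t * T u u u"
      by linarith
  qed
  show "convex (insert (N u) {y. y \<bullet> u < r + t * T u u u})"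
    using inner_boundary_point[OF u] by (rule convex_insert_open_halfspace)
qed

lemma inner_body_le:
  assumes "norm u = 1" "y \<in> body"
  shows "y \<bullet> u \<le> r + t * T u u u"
  using body_subset_exposed[OF assms(1)] assms inner_boundary_point[OF assms(1), of r t] by auto

lemma support_function_body:
  assumes "norm u = 1"
  shows "support_function body u = r + t * T u u u"
  unfolding support_function_def
proof (rule cSup_eq_maximum)
  show "r + t * T u u u \<in> (\<lambda>x. x \<bullet> u) ` body"
    using N_in_body[OF assms] inner_boundary_point[OF assms, of r t] by (metis imageI)
qed (use inner_body_le[OF assms] in auto)

lemma constant_width_body: "constant_width body (2 * r)"
  unfolding constant_width_def
proof
  fix u :: 'a assume "u \<in> sphere 0 1"
  then have "norm u = 1" "norm (- u) = 1"
    by simp_all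
  then show "support_function body u + support_function body (- u) = 2 * r"
    by (simp add: support_function_body uminus del: norm_minus_cancel)
qed

text \<open>A convex set without interior lies in a hyperplane and has width 0 in its normal
  direction, whereas every width here is \<open>2 * r\<close>.\<close>

lemma interior_body: "interior body \<noteq> {}"
proof
  assume "interior body = {}"
  then obtain a b where a: "a \<noteq> 0" "body \<subseteq> {x. a \<bullet> x = b}"
    by (rule empty_interior_subset_hyperplane[OF convex_body])
  define u where "u = a /\<^sub>R norm a"
  have u: "norm u = 1" "norm (- u) = 1"
    using a(1) by (simp_all add: u_def)
  have "y \<bullet> u = b / norm a" if "y \<in> body" for y
    using a that by (auto simp: u_def inner_commute field_simps)
  then have "N u \<bullet> u = N (- u) \<bullet> u"
    using N_in_body u by metis
  moreover have "N u \<bullet> u + N (- u) \<bullet> (- u) = 2 * r"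
    using u inner_boundary_point[of u r t] inner_boundary_point[of "- u" r t] by (simp add: uminus)
  ultimately show False
    using r_pos by simp
qed

text \<open>Adding the gaps for \<open>(u, v)\<close> and \<open>(v, u)\<close> gives strong
  monotonicity of \<open>N\<close>; Cauchy-Schwarz turns it into expansion.\<close>

lemma expanding_N:
  assumes u: "norm u = 1" and v: "norm v = 1"
  shows "2 * c * norm (u - v) \<le> norm (N u - N v)"
proof (cases "u = v")
  case False
  have "2 * c * norm (u - v) * norm (u - v) = 2 * (c * (norm (u - v))\<^sup>2)"
    by (simp add: power2_eq_square)
  also have "\<dots> \<le> (N u - N v) \<bullet> (u - v)"
    using gap[OF u v] gap[OF v u] inner_boundary_point[OF u, of r t] inner_boundary_point[OF v, of r t]
    by (simp add: inner_diff_left inner_diff_right norm_minus_commute)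
  also have "\<dots> \<le> norm (N u - N v) * norm (u - v)"
    by (rule norm_cauchy_schwarz)
  finally show ?thesis
    using False by simp
qed simp

lemma frontier_body: "frontier body = N ` sphere 0 1"
proof (intro equalityI subsetI)
  have closed: "closed body"
    by (rule compact_imp_closed[OF compact_body])
  fix x
  {
    assume "x \<in> frontier body"
    then have x: "x \<in> body" "x \<notin> rel_interior body"
      using closed by (auto simp: frontier_def rel_interior_nonempty_interior[OF interior_body])
    then obtain a where a: "a \<noteq> 0" "\<And>y. y \<in> closure body \<Longrightarrow> a \<bullet> x \<le> a \<bullet> y"
      using supporting_hyperplane_relative_frontier[OF convex_body, of x] closed by (metis closure_closed)
    \<comment> \<open>The supporting functional \<open>a\<close> is minimal at \<open>x\<close>, so
      the outer unit normal is its negative; exposedness then forces \<open>x = N u\<close>.\<close>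
    define u where "u = - (a /\<^sub>R norm a)"
    have u: "norm u = 1"
      using a(1) by (simp add: u_def)
    have "a \<bullet> x \<le> a \<bullet> N u"
      using a(2) N_in_body[OF u] closed by simp
    then have "N u \<bullet> u \<le> x \<bullet> u"
      using a(1) by (simp add: u_def inner_commute divide_right_mono)
    then have "x = N u"
      using body_subset_exposed[OF u] x(1) inner_boundary_point[OF u, of r t] by auto
    with u show "x \<in> N ` sphere 0 1"
      by auto
  next
    assume "x \<in> N ` sphere 0 1"
    then obtain u where u: "norm u = 1" "x = N u"
      by auto
    have "x \<notin> interior body"
    proof
      assume "x \<in> interior body"
      then obtain e where e: "e > 0" "ball x e \<subseteq> body"
        by (meson mem_interior)
      have "x + (e / 2) *\<^sub>R u \<in> body"
        using e u by (auto simp: dist_norm subset_iff)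
      then have "(x + (e / 2) *\<^sub>R u) \<bullet> u \<le> r + t * T u u u"
        by (rule inner_body_le[OF u(1)])
      with e(1) inner_boundary_point[OF u(1), of r t] u show False
        by (simp add: inner_add_left norm_eq_1)
    qed
    with u N_in_body closed show "x \<in> frontier body"
      by (simp add: frontier_def)
  }
qed

lemma sphere_smooth_support_function: "sphere_smooth (support_function body)"
proof -
  have o: "open (- {0 :: 'a})"
    by (simp add: open_Compl)
  have eq: "radial_ext (support_function body) x =
      r + t * (T x x x * (inverse (norm x) * (inverse (norm x) * inverse (norm x))))" if "x \<in> - {0}" for x
    using that by (simp add: radial_ext_def support_function_body scale mult_ac)
  have "smooth_on (\<lambda>x. r + t * (T x x x * (inverse (norm x) * (inverse (norm x) * inverse (norm x))))) (- {0})"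
    by (intro smooth_on_intros smooth_on_form smooth_on_norm o smooth_on_bounded_linear[OF o bounded_linear_ident]) auto
  then show ?thesis
    unfolding sphere_smooth_def using smooth_on_cong[OF o eq] by simp
qed

text \<open>The body lies in the ball of radius \<open>r + d\<close>, and projecting radially moves
  its points by at most \<open>d\<close>. Conversely, a point of the ball is a combination of
  \<open>r u\<close> and \<open>- r u\<close>, and the same combination of \<open>N u\<close> and
  \<open>N (- u)\<close> is within \<open>d\<close> of it.\<close>

lemma hausdorff_dist_body:
  assumes d: "\<And>u. norm u = 1 \<Longrightarrow> norm (N u - r *\<^sub>R u) \<le> d" and "d \<ge> 0"
  shows "hausdorff_dist body (cball 0 r) \<le> d"
proof -
  have ne: "body \<noteq> {}" "cball (0::'a) r \<noteq> {}"
    using interior_body r_pos by auto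
  have "infdist x (cball 0 r) \<le> d" if "x \<in> body" for x
  proof -
    have "body \<subseteq> cball 0 (r + d)"
      unfolding body_def
    proof (rule hull_minimal)
      show "N ` sphere 0 1 \<subseteq> cball 0 (r + d)"
      proof clarsimp
        fix u :: 'a assume u: "norm u = 1"
        show "norm (N u) \<le> r + d"
          using norm_triangle_ineq[of "r *\<^sub>R u" "N u - r *\<^sub>R u"] d[OF u] u r_pos by simp
      qed
    qed simp
    then have x: "norm x \<le> r + d"
      using that by auto
    show ?thesis
    proof (cases "norm x \<le> r")
      case True
      then show ?thesis
        using \<open>d \<ge> 0\<close> by simp
    next
      case False
      then have "x \<noteq> 0"
        using r_pos by auto
      have "infdist x (cball 0 r) \<le> dist x ((r / norm x) *\<^sub>R x)"
        using r_pos \<open>x \<noteq> 0\<close> by (intro infdist_le) simp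
      also have "\<dots> = norm ((1 - r / norm x) *\<^sub>R x)"
        by (simp add: dist_norm scaleR_left_diff_distrib)
      also have "\<dots> = norm x - r"
        using False \<open>x \<noteq> 0\<close> unfolding norm_scaleR by (simp add: abs_if field_simps)
      finally show ?thesis
        using x by simp
    qed
  qed
  moreover have "infdist y body \<le> d" if "y \<in> cball 0 r" for y
  proof -
    have "\<exists>u. norm u = 1 \<and> y = norm y *\<^sub>R u"
    proof (cases "y = 0")
      case True
      then show ?thesis
        using vector_choose_size[of 1] by auto
    next
      case False
      then show ?thesis
        by (intro exI[of _ "y /\<^sub>R norm y"]) simp
    qed
    then obtain u where u: "norm u = 1" "y = norm y *\<^sub>R u"
      by blast
    \<comment> \<open>Solves \<open>r (2 s - 1) = norm y\<close>.\<close>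
    define s where "s = (1 + norm y / r) / 2"
    have s: "0 \<le> s" "s \<le> 1"
      using that r_pos by (simp_all add: s_def)
    define z where "z = s *\<^sub>R N u + (1 - s) *\<^sub>R N (- u)"
    have "z \<in> body"
      unfolding z_def using convex_body N_in_body u(1) s by (intro convexD) auto
    then have "infdist y body \<le> dist y z"
      by (rule infdist_le)
    also have "y = s *\<^sub>R (r *\<^sub>R u) + (1 - s) *\<^sub>R (r *\<^sub>R (- u))"
      by (subst u(2)) (use r_pos in \<open>simp add: s_def field_simps flip: scaleR_left_distrib scaleR_left_diff_distrib scaleR_minus_left\<close>)
    then have "z - y = s *\<^sub>R (N u - r *\<^sub>R u) + (1 - s) *\<^sub>R (N (- u) - r *\<^sub>R (- u))"
      unfolding z_def by (simp add: algebra_simps)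
    then have "dist y z \<le> s * norm (N u - r *\<^sub>R u) + (1 - s) * norm (N (- u) - r *\<^sub>R (- u))"
      using norm_triangle_ineq[of "s *\<^sub>R (N u - r *\<^sub>R u)" "(1 - s) *\<^sub>R (N (- u) - r *\<^sub>R (- u))"] s
      by (simp add: dist_norm norm_minus_commute[of y])
    also have "\<dots> \<le> s * d + (1 - s) * d"
      using d[of u] d[of "- u"] u(1) s by (intro add_mono mult_left_mono) auto
    finally show ?thesis
      by (simp add: algebra_simps)
  qed
  ultimately show ?thesis
    unfolding hausdorff_dist_def using ne by (intro max.boundedI cSUP_least) auto
qed

end

section \<open>Smoothness of the boundary in dimension four\<close>

locale cubic_body4 = cubic_body T r t c for T :: "real^4 \<Rightarrow> real^4 \<Rightarrow> real^4 \<Rightarrow> real" and r t c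

text \<open>Near \<open>N u\<close> the boundary is parametrized by \<open>N\<close> after a graph
  chart of the hemisphere around \<open>u\<close>. Both maps expand distances up to a constant,
  which gives the homeomorphism and the injective derivative at once.\<close>

lemma (in cubic_body4) smooth_hypersurface_frontier: "smooth_hypersurface (frontier body)"
  unfolding smooth_hypersurface_def frontier_body
proof
  fix p assume "p \<in> N ` sphere 0 1"
  then obtain u where u: "norm u = 1" "p = N u"
    by auto
  define e where "e = quaternion_frame u"
  have e: "e $ i \<bullet> u = 0" "u \<bullet> e $ i = 0" "e $ i \<bullet> e $ j = (if i = j then 1 else 0)" for i j
    using orthonormal_quaternion_frame[OF u(1)] by (simp_all add: e_def orthonormal_frame_def inner_commute)
  have uu: "u \<bullet> u = 1"
    using u(1) by (simp add: norm_eq_1)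
  define U where "U = ball (0 :: real^3) 1"
  define g :: "real^3 \<Rightarrow> real^4" where
    "g y = y $ 1 *\<^sub>R e $ 1 + y $ 2 *\<^sub>R e $ 2 + y $ 3 *\<^sub>R e $ 3 + sqrt (1 - y \<bullet> y) *\<^sub>R u" for y
  have inner_3: "y \<bullet> z = y $ 1 * z $ 1 + y $ 2 * z $ 2 + y $ 3 * z $ 3" for y z :: "real^3"
    by (simp add: inner_vec_def sum_3)
  have in_U: "y \<bullet> y < 1" if "y \<in> U" for y
    using that by (simp add: U_def dist_norm norm_lt_square)
  have norm_g: "norm (g y) = 1" if "y \<in> U" for y
    using in_U[OF that] unfolding norm_eq_1 g_def
    by (simp add: inner_add_left inner_add_right e uu) (simp add: inner_3)
  have g_u: "g y \<bullet> u = sqrt (1 - y \<bullet> y)" for y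
    by (simp add: g_def inner_add_left e uu)
  \<comment> \<open>Orthogonal projection onto the tangent space undoes the graph chart and shortens
    no less than \<open>g\<close> lengthens: the squared distance only gains the square of the
    height difference.\<close>
  have expanding_g: "norm (y - z) \<le> norm (g y - g z)" for y z
  proof -
    define s where "s = sqrt (1 - y \<bullet> y) - sqrt (1 - z \<bullet> z)"
    have "g y - g z = (y - z) $ 1 *\<^sub>R e $ 1 + (y - z) $ 2 *\<^sub>R e $ 2 + (y - z) $ 3 *\<^sub>R e $ 3 + s *\<^sub>R u"
      by (simp add: g_def s_def algebra_simps)
    then have "(g y - g z) \<bullet> (g y - g z) = (y - z) \<bullet> (y - z) + s * s"
      by (simp add: inner_add_left inner_add_right e uu inner_3)
    then show ?thesis
      by (simp add: norm_le)
  qed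
  have expanding: "2 * c * norm (y - z) \<le> norm (N (g y) - N (g z))" if "y \<in> U" "z \<in> U" for y z
  proof -
    have "2 * c * norm (y - z) \<le> 2 * c * norm (g y - g z)"
      using expanding_g c_pos by (simp add: mult_left_mono)
    also have "\<dots> \<le> norm (N (g y) - N (g z))"
      by (rule expanding_N) (use norm_g that in auto)
    finally show ?thesis .
  qed
  have o: "open U"
    by (simp add: U_def)
  have smooth_nth: "smooth_on (\<lambda>y. y $ i) U" for i
    by (rule smooth_on_bounded_linear[OF o bounded_linear_vec_nth])
  have "1 - y \<bullet> y = 1 + (- 1) * (y $ 1 * y $ 1 + y $ 2 * y $ 2 + y $ 3 * y $ 3)" for y :: "real^3"
    by (simp add: inner_3)
  then have "smooth_on (\<lambda>y::real^3. 1 - y \<bullet> y) U"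
    by (simp only:) (intro smooth_on_intros o smooth_nth)
  then have smooth_sqrt: "smooth_on (\<lambda>y. sqrt (1 - y \<bullet> y)) U"
    using in_U by (intro smooth_on_intros o) simp_all
  have smooth_g: "smooth_on g U"
    unfolding g_def by (rule smooth_sqrt smooth_nth o smooth_on_intros)+
  have smooth_sharp: "smooth_on (\<lambda>y. sharp (g y) (g y)) U"
    by (rule smooth_on_euclidean[OF o]) (simp add: inner_sharp smooth_on_form o smooth_g smooth_on_intros)
  have "smooth_on (\<lambda>y. r *\<^sub>R g y + t *\<^sub>R (3 *\<^sub>R sharp (g y) (g y) + ((- 2) * T (g y) (g y) (g y)) *\<^sub>R g y)) U"
    by (intro smooth_on_intros o smooth_g smooth_sharp smooth_on_form)
  then have smooth: "smooth_on (\<lambda>y. N (g y)) U"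
    by (simp add: boundary_point_def)
  \<comment> \<open>Removing the compact image of the opposite closed hemisphere leaves an open set;
    by injectivity of \<open>N\<close> it meets the boundary exactly in the image of the open
    hemisphere.\<close>
  define V where "V = - N ` {v \<in> sphere 0 1. v \<bullet> u \<le> 0}"
  have "closed {v. v \<bullet> u \<le> 0}"
    by (rule closed_halfspace_component_le | simp add: closed_halfspace_le inner_commute[of _ u])+
  then have "compact (sphere 0 1 \<inter> {v. v \<bullet> u \<le> 0})"
    by (intro compact_Int_closed) auto
  then have "compact (N ` (sphere 0 1 \<inter> {v. v \<bullet> u \<le> 0}))"
    by (intro compact_continuous_image continuous_on_boundary_point)
  then have "open V"
    by (auto simp: V_def open_closed Int_def dest: compact_imp_closed)
  have inj_N: "v = w" if "N v = N w" "norm v = 1" "norm w = 1" for v w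
    using expanding_N[OF that(2,3)] that(1) c_pos by (simp add: mult_le_0_iff)
  have image: "(\<lambda>y. N (g y)) ` U = V \<inter> N ` sphere 0 1"
  proof (intro equalityI subsetI)
    fix x assume "x \<in> (\<lambda>y. N (g y)) ` U"
    then obtain y where y: "y \<in> U" "x = N (g y)"
      by auto
    have "g y \<bullet> u > 0"
      using in_U[OF y(1)] by (simp add: g_u)
    then show "x \<in> V \<inter> N ` sphere 0 1"
      using y norm_g[OF y(1)] inj_N[of "g y"] by (fastforce simp: V_def)
  next
    fix x assume "x \<in> V \<inter> N ` sphere 0 1"
    then obtain v where v: "norm v = 1" "x = N v" "v \<bullet> u > 0"
      by (force simp: V_def)
    \<comment> \<open>The tangential coordinates of \<open>v\<close>; positivity of
      \<open>v \<bullet> u\<close> selects the positive root used in \<open>g\<close>.\<close>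
    define y :: "real^3" where "y = (\<chi> i. v \<bullet> e $ i)"
    have "v - (v \<bullet> u) *\<^sub>R u = y $ 1 *\<^sub>R e $ 1 + y $ 2 *\<^sub>R e $ 2 + y $ 3 *\<^sub>R e $ 3"
      using quaternion_frame_expansion[OF u(1), of "v - (v \<bullet> u) *\<^sub>R u"]
      by (simp add: inner_diff_left uu e sum_3 y_def flip: e_def)
    then have v_eq: "v = y $ 1 *\<^sub>R e $ 1 + y $ 2 *\<^sub>R e $ 2 + y $ 3 *\<^sub>R e $ 3 + (v \<bullet> u) *\<^sub>R u"
      by (simp add: algebra_simps)
    have "v \<bullet> v = y \<bullet> y + (v \<bullet> u) * (v \<bullet> u)"
      by (subst (1 2) v_eq) (simp add: inner_add_left inner_add_right e uu inner_3)
    then have yy: "y \<bullet> y = 1 - (v \<bullet> u) * (v \<bullet> u)"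
      using v(1) by (simp add: norm_eq_1)
    then have "y \<bullet> y < 1"
      using v(3) by simp
    then have "y \<in> U"
      by (simp add: U_def dist_norm norm_lt_square)
    moreover have "g y = v"
      using v_eq v(3) by (simp add: g_def yy)
    ultimately show "x \<in> (\<lambda>y. N (g y)) ` U"
      using v(2) by auto
  qed
  have cont: "continuous_on U (\<lambda>y. N (g y))"
    using smooth Ck_on_imp_continuous_on unfolding smooth_on_def by blast
  have "homeomorphism U ((\<lambda>y. N (g y)) ` U) (\<lambda>y. N (g y)) (inv_into U (\<lambda>y. N (g y)))"
    using cont c_pos expanding by (intro homeomorphism_if_expanding[of _ _ "2 * c"]) (auto simp: dist_norm)
  moreover have "inj (frechet_derivative (\<lambda>y. N (g y)) (at x))" if "x \<in> U" for x
  proof (rule inj_derivative_if_expanding[where U = U and c = "2 * c"])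
    have "Ck_on (Suc 0) (\<lambda>y. N (g y)) U"
      using smooth unfolding smooth_on_def by blast
    then show "((\<lambda>y. N (g y)) has_derivative frechet_derivative (\<lambda>y. N (g y)) (at x)) (at x)"
      using that by (rule Ck_on_SucD)
  qed (use o that c_pos expanding in auto)
  moreover have "p \<in> V"
    using u inj_N[of u] uu by (fastforce simp: V_def)
  ultimately show "\<exists>(U :: (real^3) set) V \<phi> \<psi>. open U \<and> open V \<and> p \<in> V \<and>
        smooth_on \<phi> U \<and> homeomorphism U (V \<inter> N ` sphere 0 1) \<phi> \<psi> \<and>
        (\<forall>x\<in>U. inj (frechet_derivative \<phi> (at x)))"
    using o \<open>open V\<close> smooth unfolding image by blast
qed

lemma (in cubic_body4) smooth_convex_body_body: "smooth_convex_body body"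
  using compact_body convex_body interior_body smooth_hypersurface_frontier sphere_smooth_support_function
  by (simp add: smooth_convex_body_def convex_body_def)

lemma (in cubic_form) ex_cubic_body:
  assumes "r > 0" "\<epsilon> > 0"
  obtains t c where "t > 0" "cubic_body T r t c" "hausdorff_dist (cubic_body.body T r t) (cball 0 r) < \<epsilon>"
proof -
  obtain B where B: "B > 0" "\<And>x y z. \<bar>T x y z\<bar> \<le> B * norm x * norm y * norm z"
    using bounded by blast
  \<comment> \<open>The remainder in \<open>support_gap\<close> is at most
    \<open>6 B t |w|^2\<close>: 3 from \<open>T v w w\<close>, 2 from \<open>T w w w\<close> as
    \<open>|w|\<close> is at most 2, and 1 from \<open>T v v v\<close>. The first bound thus keeps
    \<open>r / 4\<close> of the main coefficient \<open>r / 2\<close>; the second keeps the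
    displacement \<open>5 B t\<close> below \<open>\<epsilon>\<close>.\<close>
  define t where "t = min (r / (24 * B)) (\<epsilon> / (10 * B))"
  have t: "t > 0" "6 * B * t \<le> r / 4" "5 * B * t < \<epsilon>"
  proof -
    show "t > 0"
      using assms B(1) by (simp add: t_def)
    have "6 * B * t \<le> 6 * B * (r / (24 * B))" "5 * B * t \<le> 5 * B * (\<epsilon> / (10 * B))"
      unfolding t_def using B(1) by (intro mult_left_mono min.cobounded1 min.cobounded2; simp)+
    then show "6 * B * t \<le> r / 4" "5 * B * t < \<epsilon>"
      using B(1) assms by simp_all
  qed
  have gap: "r / 4 * (norm (u - v))\<^sup>2 \<le> r + t * T u u u - boundary_point r t v \<bullet> u"
    if u: "norm u = 1" and v: "norm v = 1" for u v
  proof -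
    define w where "w = u - v"
    have w2: "norm w \<le> 2"
      using norm_triangle_ineq4[of u v] u v by (simp add: w_def)
    have "\<bar>T v w w\<bar> \<le> B * (norm w)\<^sup>2" "\<bar>T v v v\<bar> \<le> B"
      using B(2)[of v w w] B(2)[of v v v] v by (simp_all add: power2_eq_square mult.assoc)
    moreover have "\<bar>T w w w\<bar> \<le> 2 * (B * (norm w)\<^sup>2)"
    proof -
      have "\<bar>T w w w\<bar> \<le> norm w * (B * (norm w)\<^sup>2)"
        using B(2)[of w w w] by (simp add: power2_eq_square mult_ac)
      also have "\<dots> \<le> 2 * (B * (norm w)\<^sup>2)"
        using w2 B(1) by (intro mult_right_mono) auto
      finally show ?thesis .
    qed
    moreover have "\<bar>T v v v * (norm w)\<^sup>2\<bar> \<le> B * (norm w)\<^sup>2"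
      using \<open>\<bar>T v v v\<bar> \<le> B\<close> by (simp add: abs_mult mult_right_mono)
    ultimately have "\<bar>3 * T v w w + T w w w - T v v v * (norm w)\<^sup>2\<bar> \<le> 6 * (B * (norm w)\<^sup>2)"
      by linarith
    then have "- (6 * (B * (norm w)\<^sup>2)) \<le> 3 * T v w w + T w w w - T v v v * (norm w)\<^sup>2"
      by linarith
    then have "t * (- (6 * (B * (norm w)\<^sup>2))) \<le> t * (3 * T v w w + T w w w - T v v v * (norm w)\<^sup>2)"
      using t(1) by (intro mult_left_mono) auto
    moreover have "6 * B * t * (norm w)\<^sup>2 \<le> r / 4 * (norm w)\<^sup>2"
      using t(2) by (rule mult_right_mono) simp
    ultimately show ?thesis
      unfolding support_gap[OF u v w_def] w_def[symmetric] by (simp add: algebra_simps)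
  qed
  interpret cubic_body T r t "r / 4"
    by unfold_locales (use assms(1) gap in auto)
  have "hausdorff_dist body (cball 0 r) \<le> 5 * B * \<bar>t\<bar>"
    by (intro hausdorff_dist_body norm_boundary_point_diff B(2)) (use B(1) in auto)
  then have "hausdorff_dist body (cball 0 r) < \<epsilon>"
    using t by simp
  with t(1) cubic_body_axioms show thesis
    by (rule that)
qed

lemma ex_constant_width_body:
  assumes "r > 0" "\<epsilon> > 0" "\<alpha> \<noteq> 0" and vanishing: "quartic_volume (q_comb \<alpha> \<beta>) = 0"
  shows "\<exists>K. smooth_convex_body K \<and> constant_width K (2 * r) \<and> (\<forall>c s. K \<noteq> cball c s) \<and>
    hausdorff_dist K (cball 0 r) < \<epsilon> \<and> quartic_volume (odd_part (support_function K)) = 0"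
proof -
  obtain t c where t: "t > 0" "cubic_body (comb_form \<alpha> \<beta>) r t c"
    and dist: "hausdorff_dist (cubic_body.body (comb_form \<alpha> \<beta>) r t) (cball 0 r) < \<epsilon>"
    using comb.ex_cubic_body[OF assms(1,2)] .
  interpret cubic_body4 "comb_form \<alpha> \<beta>" r t c
    using t(2) by (rule cubic_body4.intro)
  have odd: "odd_part (support_function body) u = t * q_comb \<alpha> \<beta> u" if "norm u = 1" for u
    using that support_function_body[of u] support_function_body[of "- u"]
    by (simp add: odd_part_def q_comb_eq_comb_form comb.uminus)
  have "quartic_volume (odd_part (support_function body)) = 0"
  proof -
    \<comment> \<open>Absorbing \<open>t\<close> into the parameters makes the closed formula
      applicable and exhibits the factor \<open>t^4\<close>.\<close>
    have "odd_part (support_function body) u = q_comb (t * \<alpha>) (t * \<beta>) u" if "norm u = 1" for u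
      using odd[OF that] by (simp add: q_comb_def algebra_simps)
    then have "quartic_volume (odd_part (support_function body)) =
        pi\<^sup>2 * (- 3 * (t * \<alpha>)^4 / 128 + 3 * (t * \<alpha>)\<^sup>2 * (t * \<beta>)\<^sup>2 / 70 + (t * \<beta>)^4 / 7)"
      by (rule quartic_volume_eq)
    also have "\<dots> = t ^ 4 * quartic_volume (q_comb \<alpha> \<beta>)"
      by (simp add: quartic_volume_eq power_mult_distrib field_simps power2_eq_square power4_eq_xxxx)
    finally show ?thesis
      by (simp add: vanishing)
  qed
  moreover have "body \<noteq> cball a s" for a s
  proof
    assume ball: "body = cball a s"
    have "s > 0"
      using interior_body unfolding ball by (metis interior_cball ball_eq_empty not_le)
    have "support_function (cball a s) u = a \<bullet> u + s" if "norm u = 1" for u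
      unfolding support_function_def
    proof (rule cSup_eq_maximum)
      have "(a + s *\<^sub>R u) \<bullet> u = a \<bullet> u + s"
        using that by (simp add: inner_add_left norm_eq_1)
      moreover have "a + s *\<^sub>R u \<in> cball a s"
        using that \<open>s > 0\<close> by (simp add: dist_norm)
      ultimately show "a \<bullet> u + s \<in> (\<lambda>x. x \<bullet> u) ` cball a s"
        by (metis imageI)
      fix y assume "y \<in> (\<lambda>x. x \<bullet> u) ` cball a s"
      then obtain x where "x \<in> cball a s" and y: "y = x \<bullet> u"
        by blast
      then have x: "norm (x - a) \<le> s"
        by (simp add: dist_norm norm_minus_commute)
      have "(x - a) \<bullet> u \<le> s"
        using norm_cauchy_schwarz[of "x - a" u] x that by simp
      then show "y \<le> a \<bullet> u + s"
        by (simp add: y inner_diff_left)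
    qed
    \<comment> \<open>For a ball the odd part is linear, so three directions suffice for a
      contradiction. On the circle \<open>u$3 = u$4 = 0\<close> the cubic \<open>g\<close> vanishes,
      and \<open>f\<close> is 1/2, 0 and 0 at \<open>(1, 0)\<close>, \<open>(0, 1)\<close> and the
      diagonal point, which no linear function matches when \<open>t \<alpha>\<close> is
      nonzero.\<close>
    then have lin: "t * q_comb \<alpha> \<beta> u = a \<bullet> u" if "norm u = 1" for u
      using odd[OF that] that by (simp add: odd_part_def ball)
    define d :: real where "d = sqrt 2 / 2"
    have d: "d * d = 1 / 2" "d > 0"
      by (simp_all add: d_def)
    have vec: "t * q_comb \<alpha> \<beta> (vector [x, y, 0, 0]) = a $ 1 * x + a $ 2 * y" if "x * x + y * y = 1" for x y
      using lin[of "vector [x, y, 0, 0]"] that by (simp add: norm_eq_1_4 inner_4)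
    have "t * (\<alpha> / 2) = a $ 1" "0 = a $ 2"
      using vec[of 1 0] vec[of 0 1] by (simp_all add: q_comb_def cubic_f_def cubic_g_def)
    moreover have "0 = a $ 1 * d + a $ 2 * d"
      using vec[of d d] d by (simp add: q_comb_def cubic_f_def cubic_g_def power3_eq_cube)
    ultimately show False
      using t(1) assms(3) d(2) by simp
  qed
  ultimately show ?thesis
    using smooth_convex_body_body constant_width_body dist by blast
qed

theorem proposition9p2:
  shows
    "(\<forall>\<alpha> \<beta>. energy (q_comb \<alpha> \<beta>) = pi^2 * (\<alpha>^2 / 32 + \<beta>^2 / 12) \<and>
        quartic_volume (q_comb \<alpha> \<beta>)
          = pi^2 * (- 3 * \<alpha>^4 / 128 + 3 * \<alpha>^2 * \<beta>^2 / 70 + \<beta>^4 / 7)) \<and>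
     (\<forall>\<alpha> \<beta>. (\<exists>u\<in>sphere 0 1. q_comb \<alpha> \<beta> u \<noteq> 0) \<longrightarrow>
        - 24 / pi^2 * (energy (q_comb \<alpha> \<beta>))^2 \<le> quartic_volume (q_comb \<alpha> \<beta>) \<and>
        quartic_volume (q_comb \<alpha> \<beta>) \<le> 144 / (7 * pi^2) * (energy (q_comb \<alpha> \<beta>))^2 \<and>
        (quartic_volume (q_comb \<alpha> \<beta>) = - 24 / pi^2 * (energy (q_comb \<alpha> \<beta>))^2 \<longleftrightarrow> \<beta> = 0) \<and>
        (quartic_volume (q_comb \<alpha> \<beta>) = 144 / (7 * pi^2) * (energy (q_comb \<alpha> \<beta>))^2 \<longleftrightarrow> \<alpha> = 0)) \<and>
     (\<forall>c. (\<forall>\<alpha> \<beta>. (\<exists>u\<in>sphere 0 1. q_comb \<alpha> \<beta> u \<noteq> 0) \<longrightarrow>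
              c * (energy (q_comb \<alpha> \<beta>))^2 \<le> quartic_volume (q_comb \<alpha> \<beta>))
          \<longrightarrow> c \<le> - 24 / pi^2) \<and>
     (\<forall>c. (\<forall>\<alpha> \<beta>. (\<exists>u\<in>sphere 0 1. q_comb \<alpha> \<beta> u \<noteq> 0) \<longrightarrow>
              quartic_volume (q_comb \<alpha> \<beta>) \<le> c * (energy (q_comb \<alpha> \<beta>))^2)
          \<longrightarrow> 144 / (7 * pi^2) \<le> c) \<and>
     0 < (sqrt 1194 - 12) / 80 \<and>
     (\<forall>\<alpha> \<beta>. (\<alpha>, \<beta>) \<noteq> (0, 0) \<longrightarrow>
        (quartic_volume (q_comb \<alpha> \<beta>) = 0 \<longleftrightarrow>
           \<alpha> \<noteq> 0 \<and> \<beta>^2 / \<alpha>^2 = (sqrt 1194 - 12) / 80)) \<and>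
     (\<forall>r>0. \<forall>\<epsilon>>0. \<exists>K. smooth_convex_body K \<and> constant_width K (2 * r) \<and>
        (\<forall>c s. K \<noteq> cball c s) \<and>
        hausdorff_dist K (cball 0 r) < \<epsilon> \<and>
        quartic_volume (odd_part (support_function K)) = 0)"
proof (intro conjI[OF _ conjI[OF _ conjI[OF _ conjI[OF _ conjI[OF _ conjI]]]]])
  show "\<forall>r>0. \<forall>\<epsilon>>0. \<exists>K. smooth_convex_body K \<and> constant_width K (2 * r) \<and>
        (\<forall>c s. K \<noteq> cball c s) \<and> hausdorff_dist K (cball 0 r) < \<epsilon> \<and>
        quartic_volume (odd_part (support_function K)) = 0"
  proof (intro allI impI)
    fix r \<epsilon> :: real
    assume "r > 0" "\<epsilon> > 0"
    \<comment> \<open>A point on one of the two zero lines; it is real because the ratio is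
      positive.\<close>
    have "quartic_volume (q_comb 1 (sqrt ((sqrt 1194 - 12) / 80))) = 0"
      using vanishing_ratio_pos by (subst quartic_volume_eq_0_iff) auto
    with \<open>r > 0\<close> \<open>\<epsilon> > 0\<close> show "\<exists>K. smooth_convex_body K \<and> constant_width K (2 * r) \<and>
        (\<forall>c s. K \<noteq> cball c s) \<and> hausdorff_dist K (cball 0 r) < \<epsilon> \<and>
        quartic_volume (odd_part (support_function K)) = 0"
      by (intro ex_constant_width_body) auto
  qed
qed (use energy_eq quartic_volume_eq quartic_volume_bounds quartic_volume_bounds_optimal vanishing_ratio_pos
    quartic_volume_eq_0_iff in blast)+

end
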